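(* There exist absolute constants $c_1,c_2>0$ such that for every integer $d\geq 2$, $$c_1 \log d \leq \sup_{P\in\mathcal{P}_d} \bigg|\,\mathrm{p.v.}\int_{\mathbb{R}} e^{iP(x)}\frac{dx}{x}\bigg| \leq c_2 \log d .$$
   Context: $\mathcal{P}_d$ denotes the real vector space of all real polynomials of degree at most $d$ in one real variable. For a real function $P$, the principal value integral is $\mathrm{p.v.}\int_{\mathbb{R}} e^{iP(x)}\frac{dx}{x}=\lim_{\epsilon\to 0^+,\,R\to\infty}\int_{\epsilon\leq |x|\leq R} e^{iP(x)}\frac{dx}{x}$. *)

theory Defs
  imports "HOL-Analysis.Analysis" "HOL-Computational_Algebra.Polynomial"
begin

definition trunc_int :: "real poly \<Rightarrow> real \<Rightarrow> real \<Rightarrow> complex" where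
  "trunc_int P eps R =
     integral {x::real. eps \<le> \<bar>x\<bar> \<and> \<bar>x\<bar> \<le> R}
       (\<lambda>x. exp (\<i> * complex_of_real (poly P x)) / complex_of_real x)"

definition pv_has_value :: "real poly \<Rightarrow> complex \<Rightarrow> bool" where
  "pv_has_value P L \<longleftrightarrow>
     ((\<lambda>(eps, R). trunc_int P eps R) \<longlongrightarrow> L) (at_right 0 \<times>\<^sub>F at_top)"

end

theory Submission
  imports Defs "HOL-Probability.Sinc_Integral"
begin

text \<open>Upper bound, after Parissis, by doubling the degree: let \<open>P\<close> have degree
  less than \<open>2 N\<close> and coefficients \<open>a\<^sub>j\<close>, and choose the scale
  \<open>\<rho>\<close> at which the largest \<open>\<bar>a\<^sub>j\<bar> \<rho>\<^sup>j\<close> with \<open>j \<ge> N\<close> equals \<open>1\<close>. Below \<open>\<rho>\<close>, dropping the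
  terms of degree at least \<open>N\<close> changes the integral by \<open>O(1)\<close>. Above \<open>\<rho>\<close> the integral is \<open>O(1)\<close>:
  on \<open>[r, 4 r]\<close> with \<open>r = 4\<^sup>m \<rho>\<close> one integrates by parts where \<open>\<bar>t * P' t\<bar>\<close> exceeds \<open>2\<^sup>m N\<close>, on
  \<open>O(N)\<close> intervals of monotonicity, while Vinogradov's sublevel set estimate bounds the rest;
  both parts are \<open>O(1 / 2\<^sup>m)\<close>.

  Lower bound: the odd polynomial with derivative \<open>m (1 - t\<^sup>2)\<^sup>k\<close>, \<open>k = m\<^sup>2\<close>, stays between positive
  constants below \<open>\<pi>\<close> on \<open>[1 / (2 m), 1]\<close>, which contributes a multiple of \<open>ln m\<close>; its leading
  coefficient is so large that the tail estimate applies from \<open>2\<close> on.\<close>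

section \<open>Sublevel sets of polynomials\<close>

text \<open>A greedy choice: take the least point \<open>a\<close> of \<open>E\<close> and discard
  \<open>[a, a + \<delta>)\<close>, which costs at most \<open>\<delta>\<close> of measure, then
  recurse. Compactness supplies the least point and survives the cut.\<close>

lemma separated_points_exist:
  fixes E :: "real set"
  assumes "compact E" "measure lebesgue E > real D * \<delta>" "\<delta> > 0"
  shows "\<exists>x::nat \<Rightarrow> real. (\<forall>i\<le>D. x i \<in> E) \<and> (\<forall>i<D. x i + \<delta> \<le> x (Suc i))"
  using assms
proof (induction D arbitrary: E)
  case 0
  then have "E \<noteq> {}" by auto
  then show ?case by auto
next
  case (Suc D)
  have ne: "E \<noteq> {}" using Suc.prems by (auto simp: mult_less_0_iff)
  define a where "a = Inf E"
  have bdd: "bdd_below E"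
    using Suc.prems(1) by (simp add: compact_imp_bounded bounded_imp_bdd_below)
  have aE: "a \<in> E"
    unfolding a_def using ne bdd Suc.prems(1) by (simp add: closed_contains_Inf compact_imp_closed)
  have aL: "a \<le> y" if "y \<in> E" for y
    unfolding a_def using bdd that by (simp add: cInf_lower)
  define E' where "E' = E \<inter> {a + \<delta>..}"
  have cE': "compact E'"
    unfolding E'_def using Suc.prems(1) by (simp add: compact_Int_closed)
  have lm: "S \<in> lmeasurable" if "compact S" for S :: "real set"
    using that by (rule lmeasurable_compact)
  have sub: "E \<subseteq> E' \<union> {a..a + \<delta>}"
    using aL by (force simp: E'_def)
  have "measure lebesgue E \<le> measure lebesgue (E' \<union> {a..a + \<delta>})"
    using sub cE' Suc.prems(1) by (intro measure_mono_fmeasurable) (auto intro!: lm compact_Un fmeasurableD)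
  also have "\<dots> \<le> measure lebesgue E' + measure lebesgue {a..a + \<delta>}"
    using cE' by (intro measure_Un_le) (auto intro!: lm fmeasurableD)
  finally have "measure lebesgue E' > real D * \<delta>"
    using Suc.prems by (simp add: algebra_simps)
  from Suc.IH[OF cE' this Suc.prems(3)] obtain x where
    x: "\<forall>i\<le>D. x i \<in> E'" "\<forall>i<D. x i + \<delta> \<le> x (Suc i)" by blast
  let ?y = "case_nat a x"
  have "\<forall>i\<le>Suc D. ?y i \<in> E"
    using aE x(1) by (auto split: nat.split simp: E'_def)
  moreover have "\<forall>i<Suc D. ?y i + \<delta> \<le> ?y (Suc i)"
    using x by (auto split: nat.split simp: E'_def)
  ultimately show ?case by blast
qed

lemma separated_points_diff:
  fixes x :: "nat \<Rightarrow> real"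
  assumes "\<forall>i<D. x i + \<delta> \<le> x (Suc i)" "i \<le> j" "j \<le> D"
  shows "real (j - i) * \<delta> \<le> x j - x i"
  using assms(2,3)
proof (induction j rule: dec_induct)
  case base
  then show ?case by simp
next
  case (step n)
  then have "x n + \<delta> \<le> x (Suc n)" using assms(1) by auto
  moreover have "real (Suc n - i) = real (n - i) + 1" using step by simp
  ultimately show ?case using step by (simp add: algebra_simps)
qed

text \<open>The points are at least as spread out as an arithmetic progression of step
  \<open>\<delta>\<close>, for which the nodes to the left of \<open>x j\<close> contribute
  \<open>fact j\<close> and those to the right \<open>fact (D - j)\<close>.\<close>

lemma prod_separated_ge:
  fixes x :: "nat \<Rightarrow> real"
  assumes sep: "\<forall>i<D. x i + \<delta> \<le> x (Suc i)" and "\<delta> > 0" and "j \<le> D"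
  shows "\<delta> ^ D * fact j * fact (D - j) \<le> (\<Prod>i\<in>{..D} - {j}. \<bar>x j - x i\<bar>)"
proof -
  have split: "{..D} - {j} = {0..<j} \<union> {Suc j..D}" using assms(3) by auto
  have "fact j * \<delta> ^ j = (\<Prod>i\<in>{0..<j}. real (j - i) * \<delta>)"
    by (simp add: fact_prod_rev prod.distrib)
  also have "\<dots> \<le> (\<Prod>i\<in>{0..<j}. \<bar>x j - x i\<bar>)"
    using separated_points_diff[OF sep, of _ j] assms
    by (intro prod_mono) (auto intro: order_trans[OF _ abs_ge_self])
  finally have A: "fact j * \<delta> ^ j \<le> (\<Prod>i\<in>{0..<j}. \<bar>x j - x i\<bar>)" .
  have "fact (D - j) * \<delta> ^ (D - j) = (\<Prod>i\<in>{1..D - j}. real i * \<delta>)"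
    by (simp add: fact_prod prod.distrib)
  also have "\<dots> = (\<Prod>i\<in>{Suc j..D}. real (i - j) * \<delta>)"
    using assms(3) by (intro prod.reindex_bij_witness[of _ "\<lambda>i. i - j" "\<lambda>i. i + j"]) auto
  also have "\<dots> \<le> (\<Prod>i\<in>{Suc j..D}. \<bar>x j - x i\<bar>)"
    using separated_points_diff[OF sep, of j] assms
    by (intro prod_mono) (force intro: order_trans[OF _ abs_ge_minus_self])
  finally have B: "fact (D - j) * \<delta> ^ (D - j) \<le> (\<Prod>i\<in>{Suc j..D}. \<bar>x j - x i\<bar>)" .
  have "\<delta> ^ D * fact j * fact (D - j) = (fact j * \<delta> ^ j) * (fact (D - j) * \<delta> ^ (D - j))"
    using assms(3) by (simp add: power_add[symmetric])
  also have "\<dots> \<le> (\<Prod>i\<in>{0..<j}. \<bar>x j - x i\<bar>) * (\<Prod>i\<in>{Suc j..D}. \<bar>x j - x i\<bar>)"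
    using A B assms by (intro mult_mono) (auto intro!: prod_nonneg)
  also have "\<dots> = (\<Prod>i\<in>{..D} - {j}. \<bar>x j - x i\<bar>)"
    unfolding split by (subst prod.union_disjoint) auto
  finally show ?thesis .
qed

section \<open>Lagrange interpolation and coefficient bounds\<close>

text \<open>Each factor multiplies the bound by \<open>r + X\<close>: the shift of coefficients
  costs \<open>r\<close> under the weight \<open>r ^ k\<close>, and the constant term of the factor
  costs at most \<open>X\<close>. These products are the numerators of the Lagrange basis.\<close>

lemma coeff_prod_linear_le:
  fixes x :: "'a \<Rightarrow> real"
  assumes "finite A" "\<forall>i\<in>A. \<bar>x i\<bar> \<le> X" "r \<ge> 0"
  shows "\<bar>coeff (\<Prod>i\<in>A. [:- x i, 1:]) k\<bar> * r ^ k \<le> (r + X) ^ card A"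
  using assms(1,2)
proof (induction A arbitrary: k rule: finite_induct)
  case empty
  then show ?case by (auto simp: coeff_1)
next
  case (insert a A)
  define p where "p = (\<Prod>i\<in>A. [:- x i, 1:])"
  have X: "0 \<le> X" "\<bar>x a\<bar> \<le> X" using insert.prems by force+
  have IH: "\<bar>coeff p k\<bar> * r ^ k \<le> (r + X) ^ card A" for k
    unfolding p_def using insert by simp
  have e: "coeff ([:- x a, 1:] * p) k = - x a * coeff p k + (if k = 0 then 0 else coeff p (k - 1))"
    by (cases k) (simp_all)
  have "\<bar>coeff ([:- x a, 1:] * p) k\<bar> * r ^ k \<le>
      X * (\<bar>coeff p k\<bar> * r ^ k) + (if k = 0 then 0 else \<bar>coeff p (k - 1)\<bar> * r ^ k)"
  proof -
    have "\<bar>x a\<bar> * \<bar>coeff p k\<bar> \<le> X * \<bar>coeff p k\<bar>" using X by (intro mult_right_mono) auto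
    then have "\<bar>coeff ([:- x a, 1:] * p) k\<bar> \<le> X * \<bar>coeff p k\<bar> + (if k = 0 then 0 else \<bar>coeff p (k - 1)\<bar>)"
      unfolding e using abs_triangle_ineq[of "- x a * coeff p k" "if k = 0 then 0 else coeff p (k - 1)"]
      by (auto simp: abs_mult split: if_splits)
    from mult_right_mono[OF this, of "r ^ k"] show ?thesis using assms(3)
      by (auto simp: algebra_simps split: if_splits)
  qed
  also have "(if k = 0 then 0 else \<bar>coeff p (k - 1)\<bar> * r ^ k) \<le> r * (r + X) ^ card A"
  proof (cases k)
    case (Suc l)
    then show ?thesis using mult_left_mono[OF IH[of l] assms(3)] by (simp add: algebra_simps)
  qed (use assms(3) X in auto)
  also have "X * (\<bar>coeff p k\<bar> * r ^ k) \<le> X * (r + X) ^ card A"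
    using IH X by (intro mult_left_mono) auto
  finally show ?case using insert(1,2) by (simp add: p_def[symmetric] algebra_simps)
qed

text \<open>Both sides have degree at most \<open>D\<close> and agree at the \<open>D + 1\<close>
  nodes.\<close>

lemma lagrange_interpolation:
  fixes x :: "nat \<Rightarrow> real"
  assumes "inj_on x {..D}" "degree g \<le> D"
  shows "g = (\<Sum>j\<le>D. smult (poly g (x j) / (\<Prod>i\<in>{..D} - {j}. x j - x i)) (\<Prod>i\<in>{..D} - {j}. [:- x i, 1:]))"
    (is "g = ?h")
proof (rule poly_eqI_degree[where A = "x ` {..D}"])
  show "poly g y = poly ?h y" if y: "y \<in> x ` {..D}" for y
  proof -
    obtain l where l: "l \<le> D" "y = x l" using y by auto
    have "poly ?h y = (\<Sum>j\<le>D. if j = l then poly g (x l) else 0)"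
      unfolding poly_sum
    proof (rule sum.cong)
      fix j assume j: "j \<in> {..D}"
      show "poly (smult (poly g (x j) / (\<Prod>i\<in>{..D} - {j}. x j - x i)) (\<Prod>i\<in>{..D} - {j}. [:- x i, 1:])) y
         = (if j = l then poly g (x l) else 0)"
      proof (cases "j = l")
        case True
        have "(\<Prod>i\<in>{..D} - {l}. x l - x i) \<noteq> 0"
          using assms(1) l by (auto simp: inj_on_def)
        then show ?thesis using True l by (simp add: poly_prod)
      next
        case False
        then have "(\<Prod>i\<in>{..D} - {j}. x l - x i) = 0" using l by (auto intro!: bexI[of _ l])
        then show ?thesis using False l by (simp add: poly_prod)
      qed
    qed simp
    then show ?thesis using l by simp
  qed
  have c: "card (x ` {..D}) = Suc D" using assms(1) by (simp add: card_image)
  show "card (x ` {..D}) > degree g" using assms c by simp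
  have "degree ?h \<le> D"
  proof (rule degree_sum_le)
    fix j assume "j \<in> {..D}"
    have "degree (\<Prod>i\<in>{..D} - {j}. [:- x i, 1:]) \<le> (\<Sum>i\<in>{..D} - {j}. 1)"
      by (rule order_trans[OF degree_prod_sum_le]) auto
    also have "\<dots> \<le> D" using \<open>j \<in> {..D}\<close> by simp
    finally show "degree (smult (poly g (x j) / (\<Prod>i\<in>{..D} - {j}. x j - x i)) (\<Prod>i\<in>{..D} - {j}. [:- x i, 1:])) \<le> D"
      by (rule order_trans[OF degree_smult_le])
  qed simp
  then show "card (x ` {..D}) > degree ?h" using c by simp
qed

text \<open>The coefficient is read off Lagrange's formula. After multiplication by
  \<open>fact D\<close>, the bounds for the node products become binomial coefficients, and their
  sum \<open>2 ^ D\<close> is the factor 2 on the right.\<close>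

lemma coeff_le_of_separated_points:
  fixes x :: "nat \<Rightarrow> real"
  assumes sep: "\<forall>i<D. x i + \<delta> \<le> x (Suc i)" and "\<delta> > 0" and "degree g \<le> D"
    and small: "\<forall>i\<le>D. \<bar>poly g (x i)\<bar> \<le> \<alpha>" and X: "\<forall>i\<le>D. \<bar>x i\<bar> \<le> X" and "r \<ge> 0"
  shows "\<bar>coeff g k\<bar> * r ^ k * \<delta> ^ D * fact D \<le> \<alpha> * (2 * (r + X)) ^ D"
proof -
  have sm: "x i < x j" if "i < j" "j \<le> D" for i j
  proof -
    have "0 < real (j - i) * \<delta>" using that assms(2) by simp
    then show ?thesis using separated_points_diff[OF sep, of i j] that by linarith
  qed
  have inj: "inj_on x {..D}"
    by (rule inj_onI) (metis sm atMost_iff less_irrefl linorder_neqE_nat)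
  have X0: "0 \<le> X" and a0: "0 \<le> \<alpha>" using X small by (meson abs_ge_zero order_trans le0)+
  let ?w = "\<lambda>j. \<Prod>i\<in>{..D} - {j}. x j - x i"
  let ?p = "\<lambda>j. \<Prod>i\<in>{..D} - {j}. [:- x i, 1:]"
  have summand: "\<bar>poly g (x j) / ?w j * coeff (?p j) k\<bar> * r ^ k * \<delta> ^ D * fact D
      \<le> \<alpha> * (r + X) ^ D * real (D choose j)" if j: "j \<le> D" for j
  proof -
    have w: "\<delta> ^ D * fact j * fact (D - j) \<le> \<bar>?w j\<bar>"
      using prod_separated_ge[OF sep assms(2) j] by (simp add: abs_prod)
    have pos: "0 < \<delta> ^ D * fact j * fact (D - j)" using assms(2) by simp
    have cf: "\<bar>coeff (?p j) k\<bar> * r ^ k \<le> (r + X) ^ D"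
      using coeff_prod_linear_le[of "{..D} - {j}" x X r k] X assms j by simp
    have "\<bar>poly g (x j)\<bar> / \<bar>?w j\<bar> \<le> \<alpha> / (\<delta> ^ D * fact j * fact (D - j))"
      using w pos small j a0 by (intro frac_le) auto
    then have "\<bar>poly g (x j)\<bar> / \<bar>?w j\<bar> * (\<bar>coeff (?p j) k\<bar> * r ^ k) \<le>
        \<alpha> / (\<delta> ^ D * fact j * fact (D - j)) * (r + X) ^ D"
      using cf a0 pos assms(6) by (intro mult_mono) auto
    then have "\<bar>poly g (x j)\<bar> / \<bar>?w j\<bar> * (\<bar>coeff (?p j) k\<bar> * r ^ k) * (\<delta> ^ D * fact D) \<le>
        \<alpha> / (\<delta> ^ D * fact j * fact (D - j)) * (r + X) ^ D * (\<delta> ^ D * fact D)"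
      using assms(2) by (intro mult_right_mono) auto
    also have "\<dots> = \<alpha> * (r + X) ^ D * (fact D / (fact j * fact (D - j)))"
      using assms(2) by (simp add: field_simps)
    also have "fact D / (fact j * fact (D - j)) = real (D choose j)"
      using j by (simp add: binomial_fact)
    finally show ?thesis by (simp add: abs_mult mult_ac)
  qed
  have "coeff g k = (\<Sum>j\<le>D. poly g (x j) / ?w j * coeff (?p j) k)"
    by (subst lagrange_interpolation[OF inj assms(3)]) (simp add: coeff_sum)
  then have "\<bar>coeff g k\<bar> \<le> (\<Sum>j\<le>D. \<bar>poly g (x j) / ?w j * coeff (?p j) k\<bar>)"
    by (simp only: sum_abs)
  then have "\<bar>coeff g k\<bar> * (r ^ k * \<delta> ^ D * fact D) \<le>
      (\<Sum>j\<le>D. \<bar>poly g (x j) / ?w j * coeff (?p j) k\<bar>) * (r ^ k * \<delta> ^ D * fact D)"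
    using assms by (intro mult_right_mono) auto
  also have "\<dots> = (\<Sum>j\<le>D. \<bar>poly g (x j) / ?w j * coeff (?p j) k\<bar> * r ^ k * \<delta> ^ D * fact D)"
    by (simp only: sum_distrib_right mult.assoc)
  also have "\<dots> \<le> (\<Sum>j\<le>D. \<alpha> * (r + X) ^ D * real (D choose j))"
    using summand by (intro sum_mono) auto
  also have "\<dots> = \<alpha> * (r + X) ^ D * real (\<Sum>j\<le>D. D choose j)"
    by (simp add: sum_distrib_left)
  also have "\<dots> = \<alpha> * (2 * (r + X)) ^ D"
    by (simp only: choose_row_sum power_mult_distrib of_nat_power of_nat_numeral mult_ac)
  finally show ?thesis by (simp add: mult_ac)
qed

section \<open>Vinogradov's sublevel set estimate\<close>

text \<open>One term of the exponential series at \<open>n\<close> is at most the whole sum. This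
  crude Stirling bound makes the gaps \<open>\<mu> / (2 * D)\<close> below as good as gaps of order
  \<open>\<mu>\<close>.\<close>

lemma power_self_le_exp_fact: "real n ^ n \<le> exp 1 ^ n * fact n"
proof -
  have "real n ^ n / fact n \<le> (\<Sum>k. real n ^ k / fact k)"
    using sum_le_suminf[OF summable_exp_generic[of "real n"], of "{n}"]
    by (simp add: divide_inverse mult.commute)
  also have "\<dots> = exp (real n)"
    by (simp add: exp_def divide_inverse mult.commute)
  also have "\<dots> = exp 1 ^ n" by (simp flip: exp_of_nat_mult)
  finally show ?thesis by (simp add: field_simps)
qed

lemma compact_sublevel_set: "compact {t \<in> {a..b}. \<bar>poly g t\<bar> \<le> (\<alpha>::real)}"
proof -
  have "closed ({t. \<bar>poly g t\<bar> \<le> \<alpha>} \<inter> {a..b})"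
    by (intro closed_Int closed_Collect_le continuous_intros closed_atLeastAtMost)
  then have "compact ({a..b} \<inter> ({t. \<bar>poly g t\<bar> \<le> \<alpha>} \<inter> {a..b}))"
    by (intro compact_Int_closed compact_Icc)
  moreover have "{a..b} \<inter> ({t. \<bar>poly g t\<bar> \<le> \<alpha>} \<inter> {a..b}) = {t \<in> {a..b}. \<bar>poly g t\<bar> \<le> \<alpha>}" by auto
  ultimately show ?thesis by simp
qed

text \<open>A sublevel set of measure \<open>\<mu>\<close> contains \<open>D + 1\<close> points with
  gaps \<open>\<mu> / (2 * D)\<close>, and interpolation at these points bounds every coefficient.
  The product form avoids a \<open>D\<close>-th root and a division by the coefficient.\<close>

lemma sublevel_set_measure_le:
  fixes g :: "real poly"
  assumes "degree g \<le> D" "D > 0" "r > 0" and a0: "\<alpha> \<ge> 0"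
  shows "\<bar>coeff g k\<bar> * r ^ k * measure lebesgue {t \<in> {r..4 * r}. \<bar>poly g t\<bar> \<le> \<alpha>} ^ D \<le> \<alpha> * (60 * r) ^ D"
proof -
  define E where "E = {t \<in> {r..4 * r}. \<bar>poly g t\<bar> \<le> \<alpha>}"
  define \<mu> where "\<mu> = measure lebesgue E"
  have cE: "compact E"
    unfolding E_def by (rule compact_sublevel_set)
  show ?thesis
  proof (cases "\<mu> = 0")
    case True
    then show ?thesis unfolding E_def[symmetric] \<mu>_def[symmetric] using a0 assms(2,3) by (simp add: zero_power)
  next
    case False
    then have mu: "\<mu> > 0" using measure_nonneg[of lebesgue E] by (simp add: \<mu>_def less_le)
    \<comment> \<open>Halving leaves \<open>real D * \<delta> = \<mu> / 2\<close>, strictly below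
      \<open>\<mu>\<close> as the choice of points demands.\<close>
    define \<delta> where "\<delta> = \<mu> / (2 * real D)"
    have d: "\<delta> > 0" "\<mu> > real D * \<delta>" using mu assms by (auto simp: \<delta>_def)
    obtain x where x: "\<forall>i\<le>D. x i \<in> E" "\<forall>i<D. x i + \<delta> \<le> x (Suc i)"
      using separated_points_exist[OF cE, of D \<delta>] d by (auto simp: \<mu>_def)
    have "\<bar>coeff g k\<bar> * r ^ k * \<delta> ^ D * fact D \<le> \<alpha> * (2 * (r + 4 * r)) ^ D"
      using x assms d by (intro coeff_le_of_separated_points[OF x(2)]) (auto simp: E_def)
    \<comment> \<open>The extra factor \<open>2 * exp 1\<close> per degree turns
      \<open>\<delta> ^ D * fact D\<close> into at least \<open>\<mu> ^ D\<close>. Together with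
      \<open>2 * (r + 4 * r) = 10 * r\<close> and \<open>exp 1 \<le> 3\<close> it yields the
      constant 60.\<close>
    then have "\<bar>coeff g k\<bar> * r ^ k * \<delta> ^ D * fact D * (2 ^ D * exp 1 ^ D) \<le> \<alpha> * (2 * (r + 4 * r)) ^ D * (2 ^ D * exp 1 ^ D)"
      by (intro mult_right_mono) auto
    also have "\<dots> = \<alpha> * (20 * exp 1 * r) ^ D"
    proof -
      have "2 * (r + 4 * r) * (2 * exp 1) = 20 * exp 1 * r" by simp
      then show ?thesis by (metis power_mult_distrib mult.assoc)
    qed
    also have "\<dots> \<le> \<alpha> * (60 * r) ^ D"
      using a0 assms exp_le by (intro mult_left_mono power_mono) auto
    finally have 1: "\<bar>coeff g k\<bar> * r ^ k * \<delta> ^ D * fact D * (2 ^ D * exp 1 ^ D) \<le> \<alpha> * (60 * r) ^ D" .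
    have "\<mu> ^ D = \<delta> ^ D * 2 ^ D * real D ^ D"
    proof -
      have "\<mu> = \<delta> * 2 * real D" using assms by (simp add: \<delta>_def)
      then show ?thesis by (metis power_mult_distrib)
    qed
    also have "\<dots> \<le> \<delta> ^ D * 2 ^ D * (exp 1 ^ D * fact D)"
      using d by (intro mult_left_mono power_self_le_exp_fact) auto
    finally have "\<bar>coeff g k\<bar> * r ^ k * \<mu> ^ D \<le> \<bar>coeff g k\<bar> * r ^ k * (\<delta> ^ D * 2 ^ D * (exp 1 ^ D * fact D))"
      using assms by (intro mult_left_mono) auto
    also have "\<dots> \<le> \<alpha> * (60 * r) ^ D" using 1 by (simp add: mult_ac)
    finally show ?thesis by (simp add: \<mu>_def E_def)
  qed
qed

section \<open>Oscillatory integrals on a half-line\<close>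

definition osc :: "real poly \<Rightarrow> real \<Rightarrow> complex" where
  "osc P t = exp (\<i> * complex_of_real (poly P t)) / complex_of_real t"

lemma continuous_on_osc: "0 < a \<Longrightarrow> continuous_on {a..b} (osc P)"
  unfolding osc_def by (intro continuous_intros) auto

lemma norm_osc: "norm (osc P t) = 1 / \<bar>t\<bar>"
  by (simp add: osc_def norm_divide)

lemma osc_integrable: "0 < a \<Longrightarrow> osc P integrable_on {a..b}"
  by (intro integrable_continuous_real continuous_on_osc)

lemma norm_integral_osc_le:
  assumes "0 < r" "r \<le> u" "u \<le> v"
  shows "norm (integral {u..v} (osc P)) \<le> (v - u) / r"
proof -
  have "norm (integral {u..v} (osc P)) \<le> (1 / r) * (v - u)"
    using assms
    by (intro integral_bound continuous_on_osc) (auto simp: norm_osc intro!: divide_left_mono)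
  then show ?thesis by simp
qed

text \<open>Cut the interval at the points of \<open>S\<close>: \<open>K\<close> is paid once per
  piece, while the measure term is additive. The mixed bound lets pieces with oscillation and pieces
  inside \<open>E\<close> be counted together.\<close>

lemma norm_integral_le_partition:
  fixes f :: "real \<Rightarrow> complex"
  assumes "finite S" "continuous_on {a..b} f" "a \<le> b" "E \<in> sets lebesgue" "K \<ge> 0"
    and "\<And>u v. a \<le> u \<Longrightarrow> u \<le> v \<Longrightarrow> v \<le> b \<Longrightarrow> S \<inter> {u<..<v} = {} \<Longrightarrow>
      norm (integral {u..v} f) \<le> K + L * measure lebesgue (E \<inter> {u..v})"
  shows "norm (integral {a..b} f) \<le>
    real (card (S \<inter> {a<..<b}) + 1) * K + L * measure lebesgue (E \<inter> {a..b})"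
  using assms(2,3,6)
proof (induction "card (S \<inter> {a<..<b})" arbitrary: a b rule: less_induct)
  case less
  show ?case
  proof (cases "S \<inter> {a<..<b} = {}")
    case True
    then show ?thesis using less.prems(3)[of a b] less.prems(2) by simp
  next
    case False
    then obtain s where s: "s \<in> S" "a < s" "s < b" by auto
    have e: "S \<inter> {a<..<b} = insert s ((S \<inter> {a<..<s}) \<union> (S \<inter> {s<..<b}))" using s by auto
    have c: "card (S \<inter> {a<..<b}) = Suc (card (S \<inter> {a<..<s}) + card (S \<inter> {s<..<b}))"
      unfolding e using assms(1) by (subst card_insert_disjoint) (auto intro!: card_Un_disjoint)
    have "norm (integral {a..s} f) \<le> real (card (S \<inter> {a<..<s}) + 1) * K + L * measure lebesgue (E \<inter> {a..s})"
      using s c less.prems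
      by (intro less.hyps) (auto intro: continuous_on_subset)
    moreover have "norm (integral {s..b} f) \<le> real (card (S \<inter> {s<..<b}) + 1) * K + L * measure lebesgue (E \<inter> {s..b})"
      using s c less.prems
      by (intro less.hyps) (auto intro: continuous_on_subset)
    moreover have "integral {a..b} f = integral {a..s} f + integral {s..b} f"
      using s less.prems by (intro Henstock_Kurzweil_Integration.integral_combine[symmetric] integrable_continuous_real) auto
    moreover have "measure lebesgue (E \<inter> {a..b}) = measure lebesgue (E \<inter> {a..s}) + measure lebesgue (E \<inter> {s..b})"
    proof -
      have eq: "E \<inter> {a..b} = (E \<inter> {a..s}) \<union> (E \<inter> {s..b})" using s by auto
      have m: "E \<inter> {x..y} \<in> lmeasurable" for x y
        by (rule fmeasurable_Int_fmeasurable[OF lmeasurable_cbox[of x y, unfolded box_real] assms(4), unfolded Int_commute[of _ E]])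
      have "negligible (E \<inter> {a..s} \<inter> (E \<inter> {s..b}))"
        by (rule negligible_subset[of "{s}"]) auto
      then show ?thesis
        using measure_Un3_negligible[OF m m fmeasurable.empty_sets, of a s s b] eq by simp
    qed
    ultimately show ?thesis
      using norm_triangle_ineq[of "integral {a..s} f" "integral {s..b} f"] c
      by (simp add: algebra_simps)
  qed
qed

lemma poly_no_root_sign:
  fixes p :: "real poly"
  assumes "\<And>t. u < t \<Longrightarrow> t < v \<Longrightarrow> poly p t \<noteq> 0"
  shows "(\<forall>t\<in>{u..v}. 0 \<le> poly p t) \<or> (\<forall>t\<in>{u..v}. poly p t \<le> 0)"
proof (rule ccontr)
  assume "\<not> ?thesis"
  then obtain x y where x: "x \<in> {u..v}" "poly p x < 0" and y: "y \<in> {u..v}" "poly p y > 0"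
    by (auto simp: not_le)
  then have "x \<noteq> y" by auto
  then consider "x < y" | "y < x" by linarith
  then show False
  proof cases
    case 1
    from poly_IVT_pos[OF 1 x(2) y(2)] show False using assms x(1) y(1) by force
  next
    case 2
    from poly_IVT_neg[OF 2 y(2) x(2)] show False using assms x(1) y(1) by force
  qed
qed

text \<open>Integration by parts against \<open>1 / g\<close>, where \<open>g t = t * P' t\<close>: the integrand is
  \<open>(exp (\<i> P))' / (\<i> g)\<close>.\<close>
lemma norm_integral_osc_le_of_derivative_ge:
  fixes P :: "real poly"
  defines "g \<equiv> [:0, 1:] * pderiv P"
  assumes "0 < u" "u \<le> v" "\<alpha> > 0"
    and big: "\<And>t. t \<in> {u..v} \<Longrightarrow> \<alpha> \<le> \<bar>poly g t\<bar>"
    and mono: "(\<forall>t\<in>{u..v}. 0 \<le> poly (pderiv g) t) \<or> (\<forall>t\<in>{u..v}. poly (pderiv g) t \<le> 0)"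
  shows "norm (integral {u..v} (osc P)) \<le> 4 / \<alpha>"
proof -
  have nz: "poly g t \<noteq> 0" if "t \<in> {u..v}" for t using big[OF that] assms(4) by auto
  have gt: "poly g t = t * poly (pderiv P) t" for t by (simp add: g_def)
  define w where "w t = 1 / poly g t" for t
  define w' where "w' t = - poly (pderiv g) t / (poly g t)\<^sup>2" for t
  define e where "e t = exp (\<i> * complex_of_real (poly P t))" for t
  have ne: "norm (e t) = 1" for t by (simp add: e_def)
  have dw: "(w has_field_derivative w' t) (at t within {u..v})" if "t \<in> {u..v}" for t
    unfolding w_def w'_def using nz[OF that]
    by (auto intro!: derivative_eq_intros poly_DERIV[THEN DERIV_subset] simp: power2_eq_square)
  have de: "(e has_vector_derivative (\<i> * complex_of_real (poly (pderiv P) t) * e t)) (at t within {u..v})" for t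
  proof -
    have "((\<lambda>t. \<i> * complex_of_real (poly P t)) has_vector_derivative \<i> * complex_of_real (poly (pderiv P) t)) (at t within {u..v})"
      by (intro has_vector_derivative_mult_right bounded_linear.has_vector_derivative[OF bounded_linear_of_real])
        (auto simp: has_real_derivative_iff_has_vector_derivative[symmetric] intro: poly_DERIV[THEN DERIV_subset])
    from field_vector_diff_chain_within[OF this DERIV_exp[THEN DERIV_subset]]
    show ?thesis by (simp add: e_def[abs_def] o_def)
  qed
  have wb: "\<bar>w t\<bar> \<le> 1 / \<alpha>" if "t \<in> {u..v}" for t
    unfolding w_def using big[OF that] assms(4) by (simp add: frac_le)
  have iw: "(w' has_integral w v - w u) {u..v}"
    using assms(3) dw by (intro fundamental_theorem_of_calculus) (auto simp: has_real_derivative_iff_has_vector_derivative)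
  have d: "((\<lambda>t. e t * of_real (w t) / \<i>) has_vector_derivative
      (osc P t + e t * of_real (w' t) / \<i>)) (at t within {u..v})" if t: "t \<in> {u..v}" for t
  proof -
    have "((\<lambda>t. complex_of_real (w t)) has_vector_derivative complex_of_real (w' t)) (at t within {u..v})"
      using dw[OF t]
      by (intro bounded_linear.has_vector_derivative[OF bounded_linear_of_real])
        (simp add: has_real_derivative_iff_has_vector_derivative)
    from bounded_linear.has_vector_derivative[OF bounded_linear_divide has_vector_derivative_mult[OF de this], of \<i>]
    have "((\<lambda>t. e t * of_real (w t) / \<i>) has_vector_derivative
      (e t * of_real (w' t) + \<i> * of_real (poly (pderiv P) t) * e t * of_real (w t)) / \<i>) (at t within {u..v})" .
    moreover have "t \<noteq> 0" "poly (pderiv P) t \<noteq> 0" using nz[OF t] by (auto simp: gt)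
    then have "(e t * of_real (w' t) + \<i> * of_real (poly (pderiv P) t) * e t * of_real (w t)) / \<i>
      = osc P t + e t * of_real (w' t) / \<i>"
      by (simp add: osc_def e_def w_def gt field_simps)
    ultimately show ?thesis by simp
  qed
  have "((\<lambda>t. osc P t + e t * of_real (w' t) / \<i>) has_integral
      (e v * of_real (w v) / \<i> - e u * of_real (w u) / \<i>)) {u..v}"
    using assms(3) d by (intro fundamental_theorem_of_calculus) auto
  moreover have ii: "(\<lambda>t. e t * of_real (w' t) / \<i>) integrable_on {u..v}"
    unfolding e_def w'_def using nz by (intro integrable_continuous_real continuous_intros) auto
  ultimately have eq: "integral {u..v} (osc P) = 
      e v * of_real (w v) / \<i> - e u * of_real (w u) / \<i> - integral {u..v} (\<lambda>t. e t * of_real (w' t) / \<i>)"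
    using integral_add[OF osc_integrable[OF assms(2), of P v] ii] integral_unique
    by (metis (no_types, lifting) add_diff_cancel_right')
  have dominated: "norm (integral {u..v} (\<lambda>t. e t * of_real (w' t) / \<i>)) \<le> z"
    if "(h has_integral z) {u..v}" "\<And>t. t \<in> {u..v} \<Longrightarrow> \<bar>w' t\<bar> \<le> h t" for h z
  proof -
    have "norm (integral {u..v} (\<lambda>t. e t * of_real (w' t) / \<i>)) \<le> integral {u..v} h"
      by (rule integral_norm_bound_integral[OF ii has_integral_integrable[OF that(1)]])
        (simp add: norm_mult norm_divide ne that(2) del: atLeastAtMost_iff)
    then show ?thesis using integral_unique[OF that(1)] by simp
  qed
  \<comment> \<open>Since \<open>w'\<close> has constant sign, its absolute value integrates to the
    net change of \<open>w\<close>, at most \<open>2 / \<alpha>\<close>. The two boundary terms add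
    \<open>1 / \<alpha>\<close> each, whence the constant 4.\<close>
  have "norm (integral {u..v} (\<lambda>t. e t * of_real (w' t) / \<i>)) \<le> \<bar>w v - w u\<bar>"
    using mono
  proof
    assume *: "\<forall>t\<in>{u..v}. 0 \<le> poly (pderiv g) t"
    have "norm (integral {u..v} (\<lambda>t. e t * of_real (w' t) / \<i>)) \<le> - (w v - w u)"
      by (rule dominated[OF has_integral_neg[OF iw]]) (use * in \<open>auto simp: w'_def\<close>)
    then show ?thesis by linarith
  next
    assume *: "\<forall>t\<in>{u..v}. poly (pderiv g) t \<le> 0"
    have "norm (integral {u..v} (\<lambda>t. e t * of_real (w' t) / \<i>)) \<le> w v - w u"
      by (rule dominated[OF iw]) (use * in \<open>auto simp: w'_def\<close>)
    then show ?thesis by linarith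
  qed
  moreover have "norm (integral {u..v} (osc P)) \<le> norm (e v * of_real (w v) / \<i>) + norm (e u * of_real (w u) / \<i>)
      + norm (integral {u..v} (\<lambda>t. e t * of_real (w' t) / \<i>))"
    unfolding eq by (intro norm_triangle_le_diff add_right_mono norm_triangle_ineq4)
  ultimately show ?thesis
    using wb[of u] wb[of v] assms(3) by (simp add: norm_mult norm_divide ne)
qed

section \<open>Blocks of ratio four and the tail\<close>

text \<open>Where \<open>g t = t * P' t\<close> is at least \<open>\<alpha>\<close> in size,
  integration by parts costs \<open>4 / \<alpha>\<close> on each of at most \<open>7 * N\<close>
  pieces, in total \<open>28 / q\<close>. Elsewhere the integrand is at most \<open>1 / r\<close> on
  a set of measure at most \<open>60 * r / q\<close>.\<close>

lemma norm_integral_osc_block_le: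
  assumes "N \<ge> 1" "degree P < 2 * N" "r > 0" "q \<ge> 1" "N \<le> j"
    and lead: "q ^ (2 * N) \<le> \<bar>coeff P j\<bar> * r ^ j"
    and uv: "r \<le> u" "u \<le> v" "v \<le> 4 * r"
  shows "norm (integral {u..v} (osc P)) \<le> 88 / q"
proof -
  define g where "g = [:0, 1:] * pderiv P"
  \<comment> \<open>The factor \<open>N\<close> cancels twice: against the number of pieces, and
    against the factor \<open>j \<ge> N\<close> that \<open>g\<close> carries in its
    \<open>j\<close>-th coefficient.\<close>
  define \<alpha> where "\<alpha> = real N * q"
  define E where "E = {t \<in> {r..4 * r}. \<bar>poly g t\<bar> \<le> \<alpha>}"
  have a: "\<alpha> > 0" using assms by (simp add: \<alpha>_def)
  have cg: "coeff g i = real i * coeff P i" for i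
    by (cases i) (simp_all add: g_def coeff_pderiv)
  have "1 \<le> q ^ (2 * N)" using assms by simp
  then have Pj: "coeff P j \<noteq> 0" using lead by auto
  have j: "j \<ge> 1" using assms by simp
  have "degree g \<le> 1 + (degree P - 1)"
    unfolding g_def by (rule order_trans[OF degree_mult_le]) (simp add: degree_pderiv)
  then have dg: "degree g \<le> 2 * N - 1" using assms by linarith
  have gj: "coeff g j \<noteq> 0" using Pj j cg by simp
  \<comment> \<open>A nonzero coefficient at \<open>j \<ge> 1\<close> means that \<open>g\<close> is
    not constant, so the sets of cut points below are finite.\<close>
  have nz: "g - [:\<alpha>:] \<noteq> 0" "g + [:\<alpha>:] \<noteq> 0"
    using gj j by (metis coeff_pCons_Suc coeff_0 Suc_le_D One_nat_def add.commute diff_add_cancel add_0 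
        add_diff_cancel_right' coeff_diff coeff_add diff_zero add.right_neutral)+
  have nz': "pderiv g \<noteq> 0"
    using gj j by (metis coeff_pderiv coeff_0 Suc_le_D One_nat_def mult_eq_0_iff of_nat_eq_0_iff nat.distinct(2))
  \<comment> \<open>Between neighbouring cut points \<open>g\<close> is monotone and stays on one
    side of each of the levels \<open>\<alpha>\<close> and \<open>-\<alpha>\<close>, so a piece lies
    either wholly inside the sublevel set or wholly where
    \<open>\<bar>g\<bar> \<ge> \<alpha>\<close>.\<close>
  define S where "S = {t. poly (pderiv g) t = 0} \<union> {t. poly (g - [:\<alpha>:]) t = 0} \<union> {t. poly (g + [:\<alpha>:]) t = 0}"
  have fS: "finite S" unfolding S_def using nz nz' by (intro finite_UnI poly_roots_finite)
  have c1: "card {t. poly (pderiv g) t = 0} \<le> 2 * N"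
    using card_poly_roots_bound[OF nz'] dg by (simp add: degree_pderiv)
  have "degree (g - [:\<alpha>:]) \<le> 2 * N" "degree (g + [:\<alpha>:]) \<le> 2 * N"
    using dg by (auto intro!: degree_diff_le degree_add_le)
  then have "card {t. poly (g - [:\<alpha>:]) t = 0} \<le> 2 * N" "card {t. poly (g + [:\<alpha>:]) t = 0} \<le> 2 * N"
    using card_poly_roots_bound[OF nz(1)] card_poly_roots_bound[OF nz(2)] by linarith+
  moreover have "card S \<le> card {t. poly (pderiv g) t = 0} + card {t. poly (g - [:\<alpha>:]) t = 0} + card {t. poly (g + [:\<alpha>:]) t = 0}"
    unfolding S_def by (intro order_trans[OF card_Un_le] add_right_mono card_Un_le)
  ultimately have "card S \<le> 6 * N" using c1 by linarith
  then have cS: "card (S \<inter> {u<..<v}) \<le> 6 * N"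
    using fS by (meson card_mono inf_le1 order_trans)
  have Eb: "E \<in> lmeasurable"
    unfolding E_def by (intro lmeasurable_compact compact_sublevel_set)
  then have Em: "E \<in> sets lebesgue" by (rule fmeasurableD)
  have "norm (integral {u..v} (osc P)) \<le>
      real (card (S \<inter> {u<..<v}) + 1) * (4 / \<alpha>) + (1 / r) * measure lebesgue (E \<inter> {u..v})"
  proof (rule norm_integral_le_partition[OF fS _ uv(2) Em])
    fix x y assume xy: "u \<le> x" "x \<le> y" "y \<le> v" "S \<inter> {x<..<y} = {}"
    have nr: "poly (pderiv g) t \<noteq> 0" "poly (g - [:\<alpha>:]) t \<noteq> 0" "poly (g + [:\<alpha>:]) t \<noteq> 0"
      if "x < t" "t < y" for t using xy(4) that by (auto simp: S_def)
    have s1: "(\<forall>t\<in>{x..y}. 0 \<le> poly (pderiv g) t) \<or> (\<forall>t\<in>{x..y}. poly (pderiv g) t \<le> 0)"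
      using nr(1) by (rule poly_no_root_sign)
    have s2: "(\<forall>t\<in>{x..y}. \<alpha> \<le> poly g t) \<or> (\<forall>t\<in>{x..y}. poly g t \<le> \<alpha>)"
      using poly_no_root_sign[of x y "g - [:\<alpha>:]", OF nr(2)] by simp
    have "(\<forall>t\<in>{x..y}. 0 \<le> poly g t + \<alpha>) \<or> (\<forall>t\<in>{x..y}. poly g t + \<alpha> \<le> 0)"
      using poly_no_root_sign[of x y "g + [:\<alpha>:]", OF nr(3)] by simp
    then have s3: "(\<forall>t\<in>{x..y}. -\<alpha> \<le> poly g t) \<or> (\<forall>t\<in>{x..y}. poly g t \<le> -\<alpha>)"
      by (smt (verit))
    show "norm (integral {x..y} (osc P)) \<le> 4 / \<alpha> + (1 / r) * measure lebesgue (E \<inter> {x..y})"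
    proof (cases "\<forall>t\<in>{x..y}. \<bar>poly g t\<bar> \<le> \<alpha>")
      case True
      then have "E \<inter> {x..y} = {x..y}" using xy uv by (auto simp: E_def)
      then have "norm (integral {x..y} (osc P)) \<le> (1 / r) * measure lebesgue (E \<inter> {x..y})"
        using norm_integral_osc_le[of r x y P] xy uv assms(3) by simp
      then show ?thesis using a by (simp add: add_increasing)
    next
      case False
      have "\<alpha> \<le> \<bar>poly g t\<bar>" if "t \<in> {x..y}" for t
        using False s2 s3 that by (smt (verit))
      then have "norm (integral {x..y} (osc P)) \<le> 4 / \<alpha>"
        using xy uv assms(3) a s1 unfolding g_def
        by (intro norm_integral_osc_le_of_derivative_ge) auto
      then show ?thesis using assms(3) by (simp add: add_increasing2)
    qed
  qed (use uv assms a in \<open>auto intro!: continuous_on_osc\<close>)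
  also have "\<dots> \<le> real (7 * N) * (4 / \<alpha>) + (1 / r) * measure lebesgue E"
  proof (intro add_mono mult_right_mono mult_left_mono)
    show "real (card (S \<inter> {u<..<v}) + 1) \<le> real (7 * N)" using cS assms(1) by (intro of_nat_mono) linarith
    show "measure lebesgue (E \<inter> {u..v}) \<le> measure lebesgue E"
      using Em Eb by (intro measure_mono_fmeasurable) auto
  qed (use a assms(3) in auto)
  also have "real (7 * N) * (4 / \<alpha>) = 28 / q" using assms by (simp add: \<alpha>_def)
  also have "(1 / r) * measure lebesgue E \<le> 60 / q"
  proof -
    let ?D = "2 * N - 1" and ?m = "measure lebesgue E"
    \<comment> \<open>The degree of \<open>g\<close> is at most \<open>2 * N - 1\<close>, and
      \<open>\<alpha>\<close> accounts for the remaining power of \<open>q\<close>: after cancelling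
      \<open>N * q\<close>, both sides are powers with exponent \<open>2 * N - 1\<close>, whose root
      can be taken.\<close>
    have "real N * q ^ (2 * N) \<le> real j * (\<bar>coeff P j\<bar> * r ^ j)"
      using assms by (intro mult_mono) auto
    also have "\<dots> = \<bar>coeff g j\<bar> * r ^ j" by (simp add: cg abs_mult)
    finally have "real N * q ^ (2 * N) * ?m ^ ?D \<le> \<bar>coeff g j\<bar> * r ^ j * ?m ^ ?D"
      by (intro mult_right_mono) auto
    also have "\<dots> \<le> \<alpha> * (60 * r) ^ ?D"
      unfolding E_def using dg assms(1,3) a by (intro sublevel_set_measure_le) auto
    finally have "real N * q ^ (2 * N) * ?m ^ ?D \<le> \<alpha> * (60 * r) ^ ?D" .
    moreover have "q ^ (2 * N) = q * q ^ ?D"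
      using assms(1) by (simp add: power_eq_if[of q "2 * N"])
    ultimately have "(real N * q) * (q ^ ?D * ?m ^ ?D) \<le> (real N * q) * (60 * r) ^ ?D"
      by (simp only: \<alpha>_def mult.assoc)
    then have "q ^ ?D * ?m ^ ?D \<le> (60 * r) ^ ?D"
      by (rule mult_left_le_imp_le) (use assms in auto)
    then have "(q * ?m) ^ ?D \<le> (60 * r) ^ ?D"
      by (simp only: power_mult_distrib)
    then have "q * ?m \<le> 60 * r"
      using assms(1,3,4) by (subst (asm) power_mono_iff) (simp, simp, linarith, simp)
    then show ?thesis using assms by (simp add: field_simps)
  qed
  finally show ?thesis by (simp add: add_divide_distrib[symmetric])
qed

text \<open>The block starting at \<open>\<rho> * 4 ^ m\<close> costs \<open>88 / 2 ^ m\<close>.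
  Summing the geometric series doubles this, uniformly in the number of blocks, which is the
  induction variable \<open>k\<close>.\<close>

lemma norm_integral_osc_tail_le:
  assumes "N \<ge> 1" "degree P < 2 * N" "\<rho> > 0" "N \<le> j" "1 \<le> \<bar>coeff P j\<bar> * \<rho> ^ j"
    and "\<rho> * 4 ^ m \<le> u" "u \<le> v"
  shows "norm (integral {u..v} (osc P)) \<le> 176 / 2 ^ m"
proof -
  have block: "norm (integral {u..v} (osc P)) \<le> 88 / 2 ^ m"
    if "\<rho> * 4 ^ m \<le> u" "u \<le> v" "v \<le> \<rho> * 4 ^ Suc m" for u v m
  proof (rule norm_integral_osc_block_le[OF assms(1,2), of "\<rho> * 4 ^ m" "2 ^ m" j])
    \<comment> \<open>Rescaling by \<open>4 ^ m\<close> enlarges the \<open>j\<close>-th term by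
      \<open>4 ^ (m * j)\<close>, hence by at least \<open>(2 ^ m) ^ (2 * N)\<close> because
      \<open>j \<ge> N\<close>: the block estimate holds with \<open>q = 2 ^ m\<close>.\<close>
    have "(2 ^ m) ^ (2 * N) = ((2::real) ^ 2) ^ (m * N)"
      by (simp only: power_mult[symmetric] mult_ac)
    then have "(2 ^ m) ^ (2 * N) = (4 ^ m) ^ N * (1::real)"
      by (simp add: power_mult)
    also have "\<dots> \<le> (4 ^ m) ^ j * (\<bar>coeff P j\<bar> * \<rho> ^ j)"
      using assms by (intro mult_mono power_increasing) auto
    finally show "(2 ^ m) ^ (2 * N) \<le> \<bar>coeff P j\<bar> * (\<rho> * 4 ^ m) ^ j"
      by (simp add: power_mult_distrib mult_ac)
  qed (use that assms in auto)
  have "norm (integral {u..v} (osc P)) \<le> 176 / 2 ^ m"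
    if "\<rho> * 4 ^ m \<le> u" "u \<le> v" "v \<le> \<rho> * 4 ^ (m + k)" for k m u v
    using that
  proof (induction k arbitrary: m u v)
    case 0
    then have "u = v" by simp
    then show ?case by simp
  next
    case (Suc k)
    let ?s = "\<rho> * 4 ^ Suc m"
    consider "v \<le> ?s" | "?s \<le> u" | "u \<le> ?s" "?s \<le> v" by linarith
    then show ?case
    proof cases
      case 1
      show ?thesis using block[OF Suc.prems(1,2) 1] by (rule order_trans) (simp add: divide_right_mono)
    next
      case 2
      have "norm (integral {u..v} (osc P)) \<le> 176 / 2 ^ Suc m"
        using Suc.IH[OF 2] Suc.prems by simp
      then show ?thesis by (rule order_trans) (simp add: field_simps)
    next
      case 3
      have pos: "0 < u" using Suc.prems(1) assms(3) by (smt (verit) mult_pos_pos zero_less_power)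
      have "norm (integral {u..?s} (osc P)) \<le> 88 / 2 ^ m"
        using block[OF Suc.prems(1) 3(1)] by simp
      moreover have "norm (integral {?s..v} (osc P)) \<le> 176 / 2 ^ Suc m"
        using Suc.IH[OF order_refl 3(2)] Suc.prems by simp
      moreover have "integral {u..v} (osc P) = integral {u..?s} (osc P) + integral {?s..v} (osc P)"
        using 3 pos by (intro Henstock_Kurzweil_Integration.integral_combine[symmetric] osc_integrable) auto
      ultimately show ?thesis
        using norm_triangle_ineq[of "integral {u..?s} (osc P)" "integral {?s..v} (osc P)"]
        by simp
    qed
  qed
  moreover obtain k where "v / \<rho> < 4 ^ k" using real_arch_pow[of 4 "v / \<rho>"] by auto
  then have "v \<le> \<rho> * 4 ^ (m + k)"
  proof -
    have "v \<le> \<rho> * 4 ^ k" using \<open>v / \<rho> < 4 ^ k\<close> assms(3) by (simp add: field_simps)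
    also have "\<dots> \<le> \<rho> * 4 ^ (m + k)" using assms(3) by (intro mult_left_mono power_increasing) auto
    finally show ?thesis .
  qed
  ultimately show ?thesis using assms by blast
qed

section \<open>The principal value and the upper bound\<close>

lemma norm_exp_i_diff_le:
  "norm (exp (\<i> * complex_of_real x) - exp (\<i> * complex_of_real y)) \<le> \<bar>x - y\<bar>"
proof -
  have "exp (\<i> * complex_of_real x) - exp (\<i> * complex_of_real y) =
      exp (\<i> * complex_of_real y) * (exp (\<i> * complex_of_real (x - y)) - 1)"
    by (simp add: algebra_simps flip: exp_add)
  then have "norm (exp (\<i> * complex_of_real x) - exp (\<i> * complex_of_real y)) = 2 * \<bar>sin ((x - y) / 2)\<bar>"
    by (simp add: norm_mult dist_exp_i_1 del: of_real_diff)
  then show ?thesis using abs_sin_x_le_abs_x[of "(x - y) / 2"] by simp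
qed

text \<open>Substituting \<open>-t\<close> folds the negative half-line onto the positive one and
  changes the sign of \<open>1 / t\<close>. A truncated integral thus becomes a difference of two
  integrals over \<open>[a, b]\<close> with \<open>a > 0\<close>, to which the half-line estimates
  apply.\<close>

definition reflect :: "real poly \<Rightarrow> real poly" where
  "reflect P = pcompose P [:0, - 1:]"

lemma poly_reflect [simp]: "poly (reflect P) t = poly P (- t)"
  by (simp add: reflect_def poly_pcompose)

lemma abs_coeff_reflect [simp]: "\<bar>coeff (reflect P) j\<bar> = \<bar>coeff P j\<bar>"
  by (simp add: reflect_def coeff_pcompose_linear abs_mult power_abs)

lemma degree_reflect [simp]: "degree (reflect P) = degree P"
  by (simp add: reflect_def degree_pcompose)

lemma trunc_int_eq:
  assumes "0 < a" "a \<le> b"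
  shows "trunc_int P a b = integral {a..b} (osc P) - integral {a..b} (osc (reflect P))"
proof -
  have set: "{x::real. a \<le> \<bar>x\<bar> \<and> \<bar>x\<bar> \<le> b} = {a..b} \<union> {-b..-a}" using assms by auto
  have neg: "osc P (- t) = - osc (reflect P) t" for t by (simp add: osc_def)
  have "(osc P has_integral - integral {a..b} (osc (reflect P))) {-b..-a}"
    using has_integral_neg[OF integrable_integral[OF osc_integrable[OF assms(1), of "reflect P" b]]]
      has_integral_reflect_real[of "\<lambda>t. osc P (- t)" "- integral {a..b} (osc (reflect P))" b a]
    by (simp add: neg)
  moreover have "{a..b} \<inter> {-b..-a} = {}" using assms by auto
  ultimately have "(osc P has_integral integral {a..b} (osc P) + - integral {a..b} (osc (reflect P))) ({a..b} \<union> {-b..-a})"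
    using assms by (intro has_integral_Un integrable_integral osc_integrable) auto
  then show ?thesis
    unfolding trunc_int_def set osc_def[abs_def] by (simp add: integral_unique)
qed

lemma trunc_int_combine:
  assumes "0 < a" "a \<le> c" "c \<le> b"
  shows "trunc_int P a b = trunc_int P a c + trunc_int P c b"
proof -
  have "integral {a..b} (osc Q) = integral {a..c} (osc Q) + integral {c..b} (osc Q)" for Q
    using assms by (intro Henstock_Kurzweil_Integration.integral_combine[symmetric] osc_integrable) auto
  then show ?thesis using assms by (simp add: trunc_int_eq)
qed

lemma trunc_int_refl [simp]: "0 < a \<Longrightarrow> trunc_int P a a = 0"
  by (simp add: trunc_int_eq)

lemma norm_trunc_int_tail_le:
  assumes "N \<ge> 1" "degree P < 2 * N" "\<rho> > 0" "N \<le> j" "1 \<le> \<bar>coeff P j\<bar> * \<rho> ^ j"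
    and "\<rho> * 4 ^ m \<le> u" "u \<le> v"
  shows "norm (trunc_int P u v) \<le> 352 / 2 ^ m"
proof -
  have "0 < u" using assms(3,6) by (smt (verit) mult_pos_pos zero_less_power)
  then have "trunc_int P u v = integral {u..v} (osc P) - integral {u..v} (osc (reflect P))"
    using assms by (simp add: trunc_int_eq)
  moreover have "norm (integral {u..v} (osc P)) \<le> 176 / 2 ^ m"
    using assms by (rule norm_integral_osc_tail_le)
  moreover have "norm (integral {u..v} (osc (reflect P))) \<le> 176 / 2 ^ m"
    using assms by (intro norm_integral_osc_tail_le[of N "reflect P" \<rho> j]) auto
  ultimately show ?thesis
    using norm_triangle_ineq4[of "integral {u..v} (osc P)" "integral {u..v} (osc (reflect P))"] by simp
qed

section \<open>Halving the degree at a critical scale\<close>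

text \<open>Each nonzero coefficient has its own scale, where its term has size 1. The smallest of
  these scales is critical; excluding index 0 makes the roots meaningful.\<close>

lemma critical_scale_exists:
  fixes P :: "real poly"
  assumes "finite J" "0 \<notin> J" "k \<in> J" "coeff P k \<noteq> 0"
  obtains \<rho> j where "\<rho> > 0" "\<And>i. i \<in> J \<Longrightarrow> \<bar>coeff P i\<bar> * \<rho> ^ i \<le> 1" "j \<in> J" "\<bar>coeff P j\<bar> * \<rho> ^ j = 1"
proof -
  define r where "r i = root i (1 / \<bar>coeff P i\<bar>)" for i
  define J' where "J' = {i \<in> J. coeff P i \<noteq> 0}"
  have J': "finite J'" "J' \<noteq> {}" using assms by (auto simp: J'_def)
  have r: "r i > 0" "\<bar>coeff P i\<bar> * r i ^ i = 1" if "i \<in> J'" for i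
  proof -
    have i: "i > 0" "coeff P i \<noteq> 0" using that assms(2) by (auto simp: J'_def intro: Nat.gr0I)
    show "r i > 0" using i by (simp add: r_def)
    show "\<bar>coeff P i\<bar> * r i ^ i = 1" using i by (simp add: r_def)
  qed
  obtain j where j: "j \<in> J'" "\<And>i. i \<in> J' \<Longrightarrow> r j \<le> r i"
    using J' by (metis arg_min_if_finite(1) arg_min_least)
  show ?thesis
  proof
    show "r j > 0" "\<bar>coeff P j\<bar> * r j ^ j = 1" using r j by auto
    show "j \<in> J" using j by (simp add: J'_def)
    show "\<bar>coeff P i\<bar> * r j ^ i \<le> 1" if "i \<in> J" for i
    proof (cases "i \<in> J'")
      case True
      have "\<bar>coeff P i\<bar> * r j ^ i \<le> \<bar>coeff P i\<bar> * r i ^ i"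
        using j r True by (intro mult_left_mono power_mono) (auto intro: less_imp_le)
      then show ?thesis using r True by simp
    qed (use that in \<open>simp add: J'_def\<close>)
  qed
qed

text \<open>Divided by \<open>t\<close>, the assumed bound is exactly the derivative of
  \<open>(t / \<rho>) ^ N\<close>, so its integral below \<open>\<rho>\<close> is at most 1 whatever
  \<open>N\<close> is.\<close>

lemma norm_integral_osc_diff_le:
  fixes P Q :: "real poly"
  assumes "0 < a" "a \<le> c" "c \<le> \<rho>" "N \<ge> 1"
    and "\<And>t. 0 < t \<Longrightarrow> t \<le> \<rho> \<Longrightarrow> \<bar>poly P t - poly Q t\<bar> \<le> real N * (t / \<rho>) ^ N"
  shows "norm (integral {a..c} (osc P) - integral {a..c} (osc Q)) \<le> 1"
proof -
  have \<rho>: "\<rho> > 0" using assms by simp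
  have i: "((\<lambda>t. real N * t ^ (N - 1) / \<rho> ^ N) has_integral (c ^ N / \<rho> ^ N - a ^ N / \<rho> ^ N)) {a..c}"
    using assms(2) \<rho>
    by (intro fundamental_theorem_of_calculus)
      (auto intro!: derivative_eq_intros simp flip: has_real_derivative_iff_has_vector_derivative)
  have "norm (integral {a..c} (\<lambda>t. osc P t - osc Q t)) \<le> integral {a..c} (\<lambda>t. real N * t ^ (N - 1) / \<rho> ^ N)"
  proof (rule integral_norm_bound_integral)
    show "(\<lambda>t. osc P t - osc Q t) integrable_on {a..c}"
      using assms(1) by (intro integrable_diff osc_integrable)
    show "(\<lambda>t. real N * t ^ (N - 1) / \<rho> ^ N) integrable_on {a..c}" using i by blast
    fix t assume t: "t \<in> {a..c}"
    then have t0: "0 < t" "t \<le> \<rho>" using assms by auto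
    have "norm (osc P t - osc Q t) = norm (exp (\<i> * complex_of_real (poly P t)) - exp (\<i> * complex_of_real (poly Q t))) / t"
      using t0 by (simp add: osc_def norm_divide flip: diff_divide_distrib)
    also have "\<dots> \<le> real N * (t / \<rho>) ^ N / t"
      using t0 assms(5)[OF t0] norm_exp_i_diff_le[of "poly P t" "poly Q t"]
      by (intro divide_right_mono) auto
    also have "\<dots> = real N * t ^ (N - 1) / \<rho> ^ N"
      using t0 assms(4) by (simp add: power_divide power_eq_if[of t N])
    finally show "norm (osc P t - osc Q t) \<le> real N * t ^ (N - 1) / \<rho> ^ N" .
  qed
  also have "\<dots> = c ^ N / \<rho> ^ N - a ^ N / \<rho> ^ N" using i by (rule integral_unique)
  also have "\<dots> \<le> 1"
  proof -
    have "c ^ N / \<rho> ^ N \<le> 1" using assms \<rho> by (simp add: power_mono)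
    moreover have "0 \<le> a ^ N / \<rho> ^ N" using assms \<rho> by simp
    ultimately show ?thesis by linarith
  qed
  finally show ?thesis using assms(1) by (simp add: integral_diff osc_integrable)
qed

text \<open>The \<open>N\<close> dropped terms are each at most \<open>(t / \<rho>) ^ N\<close>, as
  \<open>i \<ge> N\<close> and \<open>t \<le> \<rho>\<close>. Allowing \<open>s\<close> to be
  \<open>t\<close> or \<open>-t\<close> covers \<open>P\<close> and its reflection at once.\<close>

lemma abs_poly_diff_cutoff_le:
  fixes P :: "real poly"
  assumes "degree P < 2 * N" "0 < t" "t \<le> \<rho>" "\<And>i. i \<in> {N..<2*N} \<Longrightarrow> \<bar>coeff P i\<bar> * \<rho> ^ i \<le> 1"
    and "\<bar>s\<bar> = t"
  shows "\<bar>poly P s - poly (poly_cutoff N P) s\<bar> \<le> real N * (t / \<rho>) ^ N"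
proof -
  have poly_eq: "poly R s = (\<Sum>i<2*N. coeff R i * s ^ i)" if "degree R < 2 * N" for R
    unfolding poly_altdef using that by (intro sum.mono_neutral_left) (auto simp: coeff_eq_0)
  have "N \<ge> 1" using assms(1) by auto
  then have dR: "degree (poly_cutoff N P) < 2 * N"
    by (intro degree_lessI) (auto simp: coeff_poly_cutoff)
  have "poly P s - poly (poly_cutoff N P) s = (\<Sum>i<2*N. (coeff P i - coeff (poly_cutoff N P) i) * s ^ i)"
    using assms(1) dR by (simp add: poly_eq sum_subtractf algebra_simps)
  also have "\<dots> = (\<Sum>i=N..<2*N. coeff P i * s ^ i)"
    by (intro sum.mono_neutral_cong_right) (auto simp: coeff_poly_cutoff)
  also have "\<bar>\<dots>\<bar> \<le> (\<Sum>i=N..<2*N. \<bar>coeff P i * s ^ i\<bar>)" by (rule sum_abs)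
  also have "\<dots> \<le> (\<Sum>i=N..<2*N. (t / \<rho>) ^ N)"
  proof (rule sum_mono)
    fix i assume i: "i \<in> {N..<2*N}"
    have "\<bar>coeff P i * s ^ i\<bar> = (\<bar>coeff P i\<bar> * \<rho> ^ i) * (t / \<rho>) ^ i"
      using assms by (simp add: abs_mult power_abs power_divide)
    also have "\<dots> \<le> 1 * (t / \<rho>) ^ N"
      using i assms by (intro mult_mono power_decreasing) (auto intro: assms(4))
    finally show "\<bar>coeff P i * s ^ i\<bar> \<le> (t / \<rho>) ^ N" by simp
  qed
  finally show ?thesis by simp
qed

text \<open>Each doubling of the degree bound costs \<open>354 = 2 + 352\<close>: 1 on each
  half-line below the critical scale, and the tail estimate above it. Constants give 0, since the
  two half-lines cancel.\<close>

lemma norm_trunc_int_le: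
  assumes "degree P < 2 ^ n" "0 < a" "a \<le> b"
  shows "norm (trunc_int P a b) \<le> 354 * real n"
  using assms
proof (induction n arbitrary: P a b)
  case 0
  then have "degree P = 0" by simp
  then obtain c where "P = [:c:]" by (rule degree_eq_zeroE)
  then have "reflect P = P" by (simp add: reflect_def)
  then show ?case using 0 by (simp add: trunc_int_eq)
next
  case (Suc n)
  define N :: nat where "N = 2 ^ n"
  have N: "N \<ge> 1" "degree P < 2 * N" using Suc.prems by (auto simp: N_def)
  define Q where "Q = poly_cutoff N P"
  have dQ: "degree Q < 2 ^ n" unfolding Q_def N_def by (intro degree_lessI) (auto simp: coeff_poly_cutoff)
  show ?case
  proof (cases "\<exists>k\<in>{N..<2*N}. coeff P k \<noteq> 0")
    case False
    have "P = Q"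
    proof (rule poly_eqI)
      show "coeff P k = coeff Q k" for k
        using False N by (cases "k < 2 * N") (auto simp: Q_def coeff_poly_cutoff coeff_eq_0)
    qed
    then show ?thesis using Suc.IH[of P a b] dQ Suc.prems by simp
  next
    case True
    then obtain k where k: "k \<in> {N..<2*N}" "coeff P k \<noteq> 0" by blast
    obtain \<rho> j where \<rho>: "\<rho> > 0" "\<And>i. i \<in> {N..<2*N} \<Longrightarrow> \<bar>coeff P i\<bar> * \<rho> ^ i \<le> 1"
        and j: "j \<in> {N..<2*N}" "\<bar>coeff P j\<bar> * \<rho> ^ j = 1"
      by (rule critical_scale_exists[OF _ _ k]) (use N in auto)
    \<comment> \<open>The critical scale clamped to \<open>[a, b]\<close>, so that either of the two
      parts may be trivial.\<close>
    define c where "c = max a (min b \<rho>)"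
    have c: "a \<le> c" "c \<le> b" "c = a \<or> c \<le> \<rho>" "c = b \<or> \<rho> \<le> c" using Suc.prems by (auto simp: c_def)
    have "norm (trunc_int P a c) \<le> norm (trunc_int Q a c) + 2"
      using c(3)
    proof
      assume "c \<le> \<rho>"
      have "norm (integral {a..c} (osc P) - integral {a..c} (osc Q)) \<le> 1"
        unfolding Q_def
        by (rule norm_integral_osc_diff_le[OF Suc.prems(2) c(1) \<open>c \<le> \<rho>\<close> N(1)],
            rule abs_poly_diff_cutoff_le[OF N(2)]) (use \<rho> in auto)
      moreover have "norm (integral {a..c} (osc (reflect P)) - integral {a..c} (osc (reflect Q))) \<le> 1"
        unfolding Q_def
        by (rule norm_integral_osc_diff_le[OF Suc.prems(2) c(1) \<open>c \<le> \<rho>\<close> N(1)], unfold poly_reflect,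
            rule abs_poly_diff_cutoff_le[OF N(2)]) (use \<rho> in auto)
      moreover have "trunc_int P a c = trunc_int Q a c
          + (integral {a..c} (osc P) - integral {a..c} (osc Q))
          - (integral {a..c} (osc (reflect P)) - integral {a..c} (osc (reflect Q)))"
        using c Suc.prems by (simp add: trunc_int_eq)
      moreover have ineq: "norm (x + y - z) \<le> norm x + 2" if "norm y \<le> 1" "norm z \<le> 1" for x y z :: complex
        using norm_triangle_ineq4[of "x + y" z] norm_triangle_ineq[of x y] that by linarith
      ultimately show ?thesis by (simp only: ineq)
    qed (use Suc.prems in simp)
    moreover have "norm (trunc_int Q a c) \<le> 354 * real n"
      using Suc.IH[OF dQ] c Suc.prems by simp
    moreover have "norm (trunc_int P c b) \<le> 352"
      using c(4)
    proof
      assume "\<rho> \<le> c"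
      then show ?thesis using norm_trunc_int_tail_le[OF N \<rho>(1), of j 0 c b] j c by simp
    qed (use c Suc.prems in simp)
    moreover have "trunc_int P a b = trunc_int P a c + trunc_int P c b"
      using c Suc.prems by (intro trunc_int_combine) auto
    ultimately show ?thesis
      using norm_triangle_ineq[of "trunc_int P a c" "trunc_int P c b"] by simp
  qed
qed

section \<open>Existence and size of the principal value\<close>

lemma pv_norm_le:
  assumes "pv_has_value P L" "\<And>a b. 0 < a \<Longrightarrow> a \<le> 1 \<Longrightarrow> 1 \<le> b \<Longrightarrow> norm (trunc_int P a b) \<le> K"
  shows "norm L \<le> K"
proof (rule Lim_norm_ubound)
  show "((\<lambda>(a, b). trunc_int P a b) \<longlongrightarrow> L) (at_right 0 \<times>\<^sub>F at_top)"
    using assms(1) by (simp add: pv_has_value_def)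
  show "at_right (0::real) \<times>\<^sub>F (at_top :: real filter) \<noteq> bot"
    by (simp add: prod_filter_eq_bot)
  have "eventually (\<lambda>a::real. 0 < a \<and> a \<le> 1) (at_right 0)"
    by (rule eventually_mono[OF eventually_at_right_real[of 0 1]]) auto
  from eventually_prodI[OF this eventually_ge_at_top[of "1::real"]]
  show "\<forall>\<^sub>F x in at_right 0 \<times>\<^sub>F at_top. norm (case x of (a, b) \<Rightarrow> trunc_int P a b) \<le> K"
    by (rule eventually_mono) (auto intro: assms(2))
qed

text \<open>With \<open>P = c + x * p\<close>, the difference \<open>P t - P (- t)\<close> is
  divisible by \<open>t\<close>, so the two half-lines together have a bounded integrand. The
  truncation is therefore Lipschitz in \<open>a\<close> and extends continuously to 0.\<close>

lemma trunc_int_tendsto_at_right_0: "\<exists>l. ((\<lambda>a. trunc_int P a 1) \<longlongrightarrow> l) (at_right 0)"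
proof -
  obtain c p where P: "P = pCons c p" by (cases P)
  have "bounded (poly p ` {-1..1})"
    by (intro compact_imp_bounded compact_continuous_image continuous_intros) auto
  then obtain B where "\<forall>x\<in>poly p ` {-1..1}. norm x \<le> B"
    unfolding bounded_iff by blast
  then have B: "\<bar>poly p t\<bar> \<le> B" if "t \<in> {-1..1}" for t using that by simp
  have B0: "B \<ge> 0" using B[of 0] by simp
  have lip: "norm (trunc_int P x y) \<le> 2 * B * (y - x)" if "0 < x" "x \<le> y" "y \<le> 1" for x y
  proof -
    have "trunc_int P x y = integral {x..y} (\<lambda>t. osc P t - osc (reflect P) t)"
      using that by (simp add: trunc_int_eq integral_diff osc_integrable)
    also have "norm \<dots> \<le> 2 * B * (y - x)"
    proof (rule integral_bound)
      show "continuous_on {x..y} (\<lambda>t. osc P t - osc (reflect P) t)"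
        using that by (intro continuous_on_diff continuous_on_osc)
      fix t assume t: "t \<in> {x..y}"
      then have t0: "0 < t" "t \<le> 1" using that by auto
      have "norm (osc P t - osc (reflect P) t) =
          norm (exp (\<i> * complex_of_real (poly P t)) - exp (\<i> * complex_of_real (poly P (- t)))) / t"
        using t0 by (simp add: osc_def norm_divide flip: diff_divide_distrib)
      also have "\<dots> \<le> \<bar>poly P t - poly P (- t)\<bar> / t"
        using t0 by (intro divide_right_mono norm_exp_i_diff_le) auto
      also have "\<dots> = \<bar>poly p t + poly p (- t)\<bar>"
        using t0 by (simp add: P abs_mult flip: distrib_left)
      also have "\<dots> \<le> 2 * B" using B[of t] B[of "- t"] t0 by simp
      finally show "norm (osc P t - osc (reflect P) t) \<le> 2 * B" .
    qed (use that in simp)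
    finally show ?thesis .
  qed
  have "(2 * B)-lipschitz_on {0<..1} (\<lambda>a. trunc_int P a 1)"
  proof (rule lipschitz_onI)
    have *: "dist (trunc_int P x 1) (trunc_int P y 1) \<le> 2 * B * dist x y"
      if "x \<in> {0<..1}" "y \<in> {0<..1}" "x \<le> y" for x y
      using trunc_int_combine[of x y 1 P] lip[of x y] that by (simp add: dist_norm)
    fix x y :: real assume "x \<in> {0<..1}" "y \<in> {0<..1}"
    then show "dist (trunc_int P x 1) (trunc_int P y 1) \<le> 2 * B * dist x y"
      using *[of x y] *[of y x] by (cases "x \<le> y") (auto simp: dist_commute)
  qed (use B0 in simp)
  then have "uniformly_continuous_on {0<..1} (\<lambda>a. trunc_int P a 1)"
    by (rule lipschitz_on_uniformly_continuous)
  moreover have "(0::real) \<in> closure {0<..1}" by simp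
  ultimately obtain l where "((\<lambda>a. trunc_int P a 1) \<longlongrightarrow> l) (at 0 within {0<..1})"
    by (rule uniformly_continuous_on_extension_at_closure)
  moreover have "at (0::real) within {0<..1} = at_right 0"
    by (rule at_within_nhd[of _ "{..<1}"]) auto
  ultimately show ?thesis by auto
qed

text \<open>Completeness along the integers provides the limit, and the Cauchy condition carries it
  over to real arguments.\<close>

lemma real_Cauchy_at_top_convergent:
  fixes f :: "real \<Rightarrow> 'a :: complete_space"
  assumes "\<And>e. e > 0 \<Longrightarrow> \<exists>M. \<forall>u v. M \<le> u \<longrightarrow> u \<le> v \<longrightarrow> dist (f u) (f v) < e"
  shows "\<exists>l. (f \<longlongrightarrow> l) at_top"
proof -
  have "Cauchy (\<lambda>n. f (real n))"
  proof (rule metric_CauchyI)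
    fix e :: real assume "e > 0"
    then obtain M where M: "\<And>u v. M \<le> u \<Longrightarrow> u \<le> v \<Longrightarrow> dist (f u) (f v) < e" using assms by blast
    obtain n where n: "M \<le> real n" using real_arch_simple by blast
    have "dist (f (real i)) (f (real j)) < e" if "n \<le> i" "n \<le> j" for i j
      using M[of "real i" "real j"] M[of "real j" "real i"] that n
      by (cases "i \<le> j") (auto simp: dist_commute)
    then show "\<exists>M. \<forall>m\<ge>M. \<forall>n\<ge>M. dist (f (real m)) (f (real n)) < e" by blast
  qed
  then obtain l where l: "(\<lambda>n. f (real n)) \<longlonglongrightarrow> l" using Cauchy_convergent convergent_def by blast
  have "(f \<longlongrightarrow> l) at_top"
  proof (rule tendstoI)
    fix e :: real assume e: "e > 0"
    then obtain M where M: "\<And>u v. M \<le> u \<Longrightarrow> u \<le> v \<Longrightarrow> dist (f u) (f v) < e / 2"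
      using assms[of "e / 2"] by auto
    have ev: "eventually (\<lambda>n. dist (f (real n)) l < e / 2) sequentially"
      using e by (intro tendstoD[OF l]) simp
    have "dist (f u) l < e" if "M \<le> u" for u
    proof -
      have "eventually (\<lambda>n. u \<le> real n) sequentially"
        using filterlim_real_sequentially by (simp add: filterlim_at_top)
      from eventually_happens[OF eventually_conj[OF this ev]] obtain n
        where n: "u \<le> real n" "dist (f (real n)) l < e / 2" by auto
      then show ?thesis using M[OF that n(1)] dist_triangle[of "f u" l "f (real n)"] by linarith
    qed
    then show "eventually (\<lambda>u. dist (f u) l < e) at_top"
      using eventually_at_top_linorder by blast
  qed
  then show ?thesis by blast
qed

text \<open>The tail estimate is used with \<open>N\<close> and \<open>j\<close> both equal to the
  degree; its bound \<open>352 / 2 ^ m\<close> tends to 0 and gives the Cauchy condition.\<close>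

lemma trunc_int_tendsto_at_top: "\<exists>l. ((\<lambda>b. trunc_int P 1 b) \<longlongrightarrow> l) at_top"
proof (rule real_Cauchy_at_top_convergent)
  fix e :: real assume e: "e > 0"
  show "\<exists>M. \<forall>u v. M \<le> u \<longrightarrow> u \<le> v \<longrightarrow> dist (trunc_int P 1 u) (trunc_int P 1 v) < e"
  proof (cases "degree P = 0")
    case True
    then obtain c where "P = [:c:]" by (rule degree_eq_zeroE)
    then have "reflect P = P" by (simp add: reflect_def)
    then show ?thesis using e by (intro exI[of _ 1]) (simp add: trunc_int_eq)
  next
    case False
    let ?N = "degree P"
    obtain \<rho> j where \<rho>: "\<rho> > 0" "j \<in> {?N}" "\<bar>coeff P j\<bar> * \<rho> ^ j = 1"
      by (rule critical_scale_exists[of "{?N}" ?N P]) (use False in auto)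
    obtain m where m: "352 / e < 2 ^ m" using real_arch_pow[of 2 "352 / e"] by auto
    show ?thesis
    proof (intro exI allI impI)
      fix u v :: real assume uv: "max 1 (\<rho> * 4 ^ m) \<le> u" "u \<le> v"
      have "dist (trunc_int P 1 u) (trunc_int P 1 v) = norm (trunc_int P u v)"
        using uv trunc_int_combine[of 1 u v P] by (simp add: dist_norm)
      also have "\<dots> \<le> 352 / 2 ^ m"
        using False \<rho> uv by (intro norm_trunc_int_tail_le[of ?N P \<rho> j]) auto
      also have "\<dots> < e" using m e by (simp add: field_simps)
      finally show "dist (trunc_int P 1 u) (trunc_int P 1 v) < e" .
    qed
  qed
qed

text \<open>Splitting at 1 separates the two truncation parameters, so the joint limit is a sum of
  two one-parameter limits.\<close>

lemma pv_exists: "\<exists>L. pv_has_value P L"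
proof -
  obtain l1 where l1: "((\<lambda>a. trunc_int P a 1) \<longlongrightarrow> l1) (at_right 0)"
    using trunc_int_tendsto_at_right_0 by blast
  obtain l2 where l2: "((\<lambda>b. trunc_int P 1 b) \<longlongrightarrow> l2) at_top"
    using trunc_int_tendsto_at_top by blast
  have "((\<lambda>x. trunc_int P (fst x) 1 + trunc_int P 1 (snd x)) \<longlongrightarrow> l1 + l2) (at_right 0 \<times>\<^sub>F at_top)"
    by (intro tendsto_add filterlim_compose[OF l1] filterlim_compose[OF l2] filterlim_fst filterlim_snd)
  moreover have "eventually (\<lambda>a::real. 0 < a \<and> a \<le> 1) (at_right 0)"
    by (rule eventually_mono[OF eventually_at_right_real[of 0 1]]) auto
  from eventually_prodI[OF this eventually_ge_at_top[of "1::real"]]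
  have "\<forall>\<^sub>F x in at_right 0 \<times>\<^sub>F at_top. trunc_int P (fst x) 1 + trunc_int P 1 (snd x) = (case x of (a, b) \<Rightarrow> trunc_int P a b)"
  proof (rule eventually_mono)
    fix x :: "real \<times> real"
    assume "(0 < fst x \<and> fst x \<le> 1) \<and> 1 \<le> snd x"
    then show "trunc_int P (fst x) 1 + trunc_int P 1 (snd x) = (case x of (a, b) \<Rightarrow> trunc_int P a b)"
      using trunc_int_combine[of "fst x" 1 "snd x" P] by (simp add: case_prod_beta)
  qed
  ultimately have "((\<lambda>(a, b). trunc_int P a b) \<longlongrightarrow> l1 + l2) (at_right 0 \<times>\<^sub>F at_top)"
    by (rule Lim_transform_eventually)
  then show ?thesis unfolding pv_has_value_def by blast
qed

text \<open>For \<open>2 ^ n \<le> d < 2 ^ (n + 1)\<close> the bound is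
  \<open>354 * (n + 1)\<close>, and \<open>(n + 1) * ln 2 \<le> 2 * ln d\<close>, whence
  \<open>708 = 2 * 354\<close>.\<close>

lemma pv_norm_le_ln:
  assumes "pv_has_value P L" "degree P \<le> d" "d \<ge> 2"
  shows "norm L \<le> 708 / ln 2 * ln (real d)"
proof -
  obtain n where n: "2 ^ n \<le> d" "d < 2 ^ (n + 1)" using ex_power_ivl1[of 2 d] assms(3) by auto
  have "norm L \<le> 354 * real (n + 1)"
    by (rule pv_norm_le[OF assms(1)], rule norm_trunc_int_le) (use n assms in auto)
  moreover have "real (n + 1) * ln 2 \<le> 2 * ln (real d)"
  proof -
    have "real (2 ^ n) \<le> real d" using n by (intro of_nat_mono) 
    then have "ln ((2::real) ^ n) \<le> ln (real d)" using assms(3) by simp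
    moreover have "ln 2 \<le> ln (real d)" using assms(3) by simp
    ultimately show ?thesis by (simp add: ln_realpow algebra_simps)
  qed
  then have "real (n + 1) \<le> 2 * ln (real d) / ln 2" by (simp add: field_simps)
  ultimately show ?thesis by simp
qed

section \<open>The lower bound\<close>

lemma pv_norm_ge:
  assumes "pv_has_value P L" "\<delta> > 0"
    and "\<And>a b. 0 < a \<Longrightarrow> a \<le> \<delta> \<Longrightarrow> M \<le> b \<Longrightarrow> K \<le> norm (trunc_int P a b)"
  shows "K \<le> norm L"
proof (rule tendsto_lowerbound)
  show "((\<lambda>x. norm (case x of (a, b) \<Rightarrow> trunc_int P a b)) \<longlongrightarrow> norm L) (at_right 0 \<times>\<^sub>F at_top)"
    using assms(1) unfolding pv_has_value_def by (rule tendsto_norm)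
  show "at_right (0::real) \<times>\<^sub>F (at_top :: real filter) \<noteq> bot"
    by (simp add: prod_filter_eq_bot)
  have "eventually (\<lambda>a::real. 0 < a \<and> a \<le> \<delta>) (at_right 0)"
    by (rule eventually_mono[OF eventually_at_right_real[OF assms(2)]]) auto
  from eventually_prodI[OF this eventually_ge_at_top[of M]]
  show "\<forall>\<^sub>F x in at_right 0 \<times>\<^sub>F at_top. K \<le> norm (case x of (a, b) \<Rightarrow> trunc_int P a b)"
    by (rule eventually_mono) (auto intro: assms(3))
qed

text \<open>For odd \<open>P\<close> only the sine survives, so a sign condition on
  \<open>sin (P t)\<close> excludes cancellation.\<close>

lemma osc_odd_diff:
  assumes "\<And>t. poly P (- t) = - poly P t"
  shows "osc P t - osc (reflect P) t = 2 * \<i> * complex_of_real (sin (poly P t) / t)"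
proof -
  have "exp (\<i> * complex_of_real x) - exp (\<i> * complex_of_real (- x)) = 2 * \<i> * complex_of_real (sin x)" for x
    by (simp only: cis_conv_exp[symmetric]) (simp add: complex_eq_iff)
  from this[of "poly P t"] show ?thesis
    by (simp add: osc_def assms flip: diff_divide_distrib)
qed

lemma trunc_int_odd:
  assumes "\<And>t. poly P (- t) = - poly P t" "0 < a" "a \<le> b" "((\<lambda>t. sin (poly P t) / t) has_integral y) {a..b}"
  shows "trunc_int P a b = 2 * \<i> * complex_of_real y"
proof -
  have "trunc_int P a b = integral {a..b} (\<lambda>t. osc P t - osc (reflect P) t)"
    using assms by (simp add: trunc_int_eq integral_diff osc_integrable)
  also have "\<dots> = 2 * \<i> * complex_of_real y"
    unfolding osc_odd_diff[OF assms(1)]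
    by (intro integral_unique has_integral_mult_right has_integral_of_real assms(4))
  finally show ?thesis .
qed

text \<open>The Dirichlet integral. It settles the lower bound for those \<open>d\<close> too small
  for the logarithmic construction.\<close>

lemma pv_linear: "pv_has_value [:0, 1:] (\<i> * complex_of_real pi)"
proof -
  have tr: "trunc_int [:0, 1:] a b = 2 * \<i> * complex_of_real (Si b - Si a)" if "0 < a" "a \<le> b" for a b
  proof (rule trunc_int_odd)
    have "(Si has_real_derivative sin t / t) (at t within {a..b})" if "t \<in> {a..b}" for t
      using DERIV_Si[of t] that \<open>0 < a\<close> by (auto intro: DERIV_subset)
    then show "((\<lambda>t. sin (poly [:0, 1:] t) / t) has_integral (Si b - Si a)) {a..b}"
      using that
      by (intro fundamental_theorem_of_calculus)
        (auto simp flip: has_real_derivative_iff_has_vector_derivative)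
  qed (use that in auto)
  have "Si 0 = 0" by (simp add: Si_def zero_ereal_def)
  moreover have "(Si \<longlongrightarrow> Si 0) (at_right 0)"
    using isCont_Si[of 0] by (simp add: isCont_def filterlim_at_split)
  ultimately have s0: "(Si \<longlongrightarrow> 0) (at_right 0)" by simp
  have "((\<lambda>x. 2 * \<i> * complex_of_real (Si (snd x) - Si (fst x))) \<longlongrightarrow> 2 * \<i> * complex_of_real (pi / 2 - 0)) (at_right 0 \<times>\<^sub>F at_top)"
    by (intro tendsto_intros filterlim_compose[OF Si_at_top] filterlim_compose[OF s0] filterlim_fst filterlim_snd)
  moreover have "eventually (\<lambda>a::real. 0 < a \<and> a \<le> 1) (at_right 0)"
    by (rule eventually_mono[OF eventually_at_right_real[of 0 1]]) auto
  from eventually_prodI[OF this eventually_ge_at_top[of "1::real"]]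
  have "\<forall>\<^sub>F x in at_right 0 \<times>\<^sub>F at_top. 2 * \<i> * complex_of_real (Si (snd x) - Si (fst x)) = (case x of (a, b) \<Rightarrow> trunc_int [:0, 1:] a b)"
    by (rule eventually_mono) (simp add: tr case_prod_beta)
  ultimately show ?thesis
    unfolding pv_has_value_def using Lim_transform_eventually by fastforce
qed

section \<open>A polynomial resembling a step function\<close>

lemma antiderivative_poly_exists:
  fixes p :: "real poly"
  shows "\<exists>P. pderiv P = p \<and> poly P 0 = 0"
proof -
  define P where "P = (\<Sum>i\<le>degree p. monom (coeff p i / real (Suc i)) (Suc i))"
  have "pderiv P = (\<Sum>i\<le>degree p. monom (coeff p i) i)"
    unfolding P_def using higher_pderiv_sum[of 1 "\<lambda>i. monom (coeff p i / real (Suc i)) (Suc i)" "{..degree p}"]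
    by (simp add: pderiv_monom del: of_nat_Suc)
  also have "\<dots> = p" by (rule poly_as_sum_of_monoms)
  finally show ?thesis by (intro exI[of _ P]) (simp add: P_def poly_sum poly_monom)
qed

text \<open>Both follow from Bernoulli's inequality; the first also uses
  \<open>(1 - t\<^sup>2) * (1 + t\<^sup>2) \<le> 1\<close>. With \<open>k = m\<^sup>2\<close>, its
  right side times \<open>m\<close> is the derivative of \<open>arctan (m * t)\<close>.\<close>

lemma kernel_bounds:
  fixes t :: real
  assumes "0 \<le> t" "t \<le> 1"
  shows "(1 - t\<^sup>2) ^ k \<le> 1 / (1 + real k * t\<^sup>2)" "1 - real k * t\<^sup>2 \<le> (1 - t\<^sup>2) ^ k"
proof -
  have t2: "t\<^sup>2 \<le> 1" using assms by (simp add: power_le_one)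
  have "(1 - t\<^sup>2) ^ k * (1 + real k * t\<^sup>2) \<le> (1 - t\<^sup>2) ^ k * (1 + t\<^sup>2) ^ k"
    using t2 by (intro mult_left_mono Bernoulli_inequality order_trans[OF _ zero_le_power2]) auto
  also have "\<dots> = (1 - t\<^sup>2 * t\<^sup>2) ^ k" by (simp add: algebra_simps flip: power_mult_distrib)
  also have "\<dots> \<le> 1" using mult_le_one[OF t2 _ t2] by (intro power_le_one) auto
  finally show "(1 - t\<^sup>2) ^ k \<le> 1 / (1 + real k * t\<^sup>2)"
    by (subst pos_le_divide_eq) (auto intro: add_pos_nonneg)
  show "1 - real k * t\<^sup>2 \<le> (1 - t\<^sup>2) ^ k"
    using Bernoulli_inequality[of "- t\<^sup>2" k] t2 by simp
qed

lemma step_polynomial_exists: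
  assumes "m \<ge> (1::nat)"
  obtains P :: "real poly" where
    "degree P = 2 * m\<^sup>2 + 1" "1 \<le> \<bar>coeff P (2 * m\<^sup>2 + 1)\<bar> * 2 ^ (2 * m\<^sup>2 + 1)"
    "\<And>t. poly P (- t) = - poly P t"
    "\<And>t. 0 \<le> t \<Longrightarrow> t \<le> 1 \<Longrightarrow> 0 \<le> poly P t \<and> poly P t \<le> pi / 2"
    "\<And>t. 1 / (2 * real m) \<le> t \<Longrightarrow> t \<le> 1 \<Longrightarrow> 3 / 8 \<le> poly P t"
proof -
  define k where "k = m\<^sup>2"
  define q :: "real poly" where "q = [:1, 0, -1:]"
  define p where "p = smult (real m) (q ^ k)"
  obtain P where P: "pderiv P = p" "poly P 0 = 0" using antiderivative_poly_exists by blast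
  have m: "real m > 0" using assms by simp
  have pt: "poly p t = real m * (1 - t\<^sup>2) ^ k" for t
    by (simp add: p_def q_def poly_power power2_eq_square)
  have D: "(poly P has_real_derivative poly p t) (at t)" for t
    using poly_DERIV[of P t] P(1) by simp
  have dq: "degree (q ^ k) = 2 * k" by (subst degree_power_eq) (auto simp: q_def)
  then have dp: "degree p = 2 * k" using m by (simp add: p_def)
  have "k \<ge> 1" using assms by (simp add: k_def)
  then have dP: "degree P = 2 * k + 1" using degree_pderiv[of P] P(1) dp by simp
  \<comment> \<open>Integration divides the leading coefficient by \<open>2 * k + 1\<close>, so that
    of \<open>P\<close> has absolute value \<open>m / (2 * k + 1)\<close>, and
    \<open>2 * k + 1 \<le> 2 ^ (2 * k + 1)\<close>.\<close>
  have "coeff (q ^ k) (2 * k) = (-1) ^ k"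
    using lead_coeff_power[of q k] dq by (simp add: q_def)
  then have "real (2 * k + 1) * coeff P (2 * k + 1) = real m * (-1) ^ k"
    using coeff_pderiv[of P "2 * k"] P(1) by (simp add: p_def)
  then have "real (2 * k + 1) * \<bar>coeff P (2 * k + 1)\<bar> = real m"
    by (metis abs_mult abs_of_nat abs_power_minus abs_one power_one mult.right_neutral)
  moreover have "real (2 * k + 1) * \<bar>coeff P (2 * k + 1)\<bar> \<le> 2 ^ (2 * k + 1) * \<bar>coeff P (2 * k + 1)\<bar>"
    by (intro mult_right_mono less_imp_le[OF of_nat_less_two_power]) auto
  moreover have "1 \<le> real m" using assms by simp
  ultimately have lead: "1 \<le> \<bar>coeff P (2 * k + 1)\<bar> * 2 ^ (2 * k + 1)" by (simp only: mult.commute)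
  have odd: "poly P (- t) = - poly P t" for t
  proof -
    have "((\<lambda>t. poly P t + poly P (- t)) has_real_derivative 0) (at t)" for t
      by (auto intro!: derivative_eq_intros DERIV_chain2[OF D] D simp: pt P(1))
    then have "poly P t + poly P (- t) = poly P 0 + poly P (- 0)"
      using DERIV_isconst_all[of "\<lambda>t. poly P t + poly P (- t)" t 0] by blast
    then show ?thesis using P(2) by simp
  qed
  have p0: "0 \<le> poly p t" if "0 \<le> t" "t \<le> 1" for t
    using that m by (simp add: pt power_le_one)
  have mono: "poly P s \<le> poly P t" if "0 \<le> s" "s \<le> t" "t \<le> 1" for s t
    using that by (intro DERIV_nonneg_imp_nondecreasing[OF that(2)]) (metis D p0 order_trans)
  have up: "poly P t \<le> pi / 2" if t: "0 \<le> t" "t \<le> 1" for t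
  proof -
    \<comment> \<open>Comparing derivatives shows that \<open>P\<close> stays below
      \<open>arctan (m * t)\<close>.\<close>
    have "arctan (real m * 0) - poly P 0 \<le> arctan (real m * t) - poly P t"
    proof (rule DERIV_nonneg_imp_nondecreasing[OF t(1)])
      fix s assume s: "0 \<le> s" "s \<le> t"
      have "((\<lambda>s. arctan (real m * s) - poly P s) has_real_derivative
          (real m / (1 + (real m * s)\<^sup>2) - poly p s)) (at s)"
        by (auto intro!: derivative_eq_intros D simp: divide_inverse P(1))
      moreover have "poly p s \<le> real m * (1 / (1 + real k * s\<^sup>2))"
        unfolding pt using kernel_bounds(1)[of s k] s t m by (intro mult_left_mono) auto
      then have "0 \<le> real m / (1 + (real m * s)\<^sup>2) - poly p s"
        by (simp add: k_def power_mult_distrib)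
      ultimately show "\<exists>y. ((\<lambda>s. arctan (real m * s) - poly P s) has_real_derivative y) (at s) \<and> 0 \<le> y"
        by blast
    qed
    then show ?thesis using P(2) arctan_ubound[of "real m * t"] by simp
  qed
  define \<delta> where "\<delta> = 1 / (2 * real m)"
  have \<delta>: "0 \<le> \<delta>" "\<delta> \<le> 1" using assms by (auto simp: \<delta>_def field_simps)
  have low: "3 / 8 \<le> poly P \<delta>"
  proof -
    \<comment> \<open>Up to \<open>\<delta> = 1 / (2 * m)\<close> one has
      \<open>k * s\<^sup>2 \<le> 1 / 4\<close>, so the slope is at least \<open>3 / 4 * m\<close>,
      and \<open>3 / 4 * m * \<delta> = 3 / 8\<close>.\<close>
    have "poly P 0 - 3 / 4 * real m * 0 \<le> poly P \<delta> - 3 / 4 * real m * \<delta>"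
    proof (rule DERIV_nonneg_imp_nondecreasing[OF \<delta>(1)])
      fix s assume s: "0 \<le> s" "s \<le> \<delta>"
      have "((\<lambda>s. poly P s - 3 / 4 * real m * s) has_real_derivative poly p s - 3 / 4 * real m) (at s)"
        by (auto intro!: derivative_eq_intros D simp: P(1))
      moreover have "real k * s\<^sup>2 \<le> real k * \<delta>\<^sup>2" using s by (intro mult_left_mono power_mono) auto
      then have "3 / 4 \<le> 1 - real k * s\<^sup>2"
        using m by (simp add: k_def \<delta>_def power_divide power_mult_distrib)
      then have "3 / 4 \<le> (1 - s\<^sup>2) ^ k"
        using kernel_bounds(2)[of s k] s \<delta> by linarith
      then have "0 \<le> poly p s - 3 / 4 * real m" using m by (simp add: pt)
      ultimately show "\<exists>y. ((\<lambda>s. poly P s - 3 / 4 * real m * s) has_real_derivative y) (at s) \<and> 0 \<le> y"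
        by blast
    qed
    then show ?thesis using P(2) m by (simp add: \<delta>_def)
  qed
  show ?thesis
  proof (rule that[of P])
    show "0 \<le> poly P t \<and> poly P t \<le> pi / 2" if "0 \<le> t" "t \<le> 1" for t
      using mono[of 0 t] up[of t] that P(2) by simp
    show "3 / 8 \<le> poly P t" if "1 / (2 * real m) \<le> t" "t \<le> 1" for t
      using mono[of \<delta> t] low \<delta> that by (simp add: \<delta>_def)
  qed (use dP lead odd in \<open>simp_all add: k_def\<close>)
qed

text \<open>The integral of \<open>sin (P t) / t\<close> is at least
  \<open>sin (3 / 8) * ln (2 * m)\<close> over \<open>[1 / (2 * m), 1]\<close> and nonnegative to
  the left of it. The loss 354 is 2 from \<open>[1, 2]\<close>, estimated trivially, and 352 from
  the tail.\<close>

lemma pv_large_exists: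
  assumes "m \<ge> (1::nat)"
  shows "\<exists>P L. degree P = 2 * m\<^sup>2 + 1 \<and> pv_has_value P L \<and> 2 * sin (3 / 8) * ln (2 * real m) - 354 \<le> norm L"
proof -
  obtain P where P: "degree P = 2 * m\<^sup>2 + 1" "1 \<le> \<bar>coeff P (2 * m\<^sup>2 + 1)\<bar> * 2 ^ (2 * m\<^sup>2 + 1)"
    and odd: "\<And>t. poly P (- t) = - poly P t"
    and rng: "\<And>t. 0 \<le> t \<Longrightarrow> t \<le> 1 \<Longrightarrow> 0 \<le> poly P t \<and> poly P t \<le> pi / 2"
    and low: "\<And>t. 1 / (2 * real m) \<le> t \<Longrightarrow> t \<le> 1 \<Longrightarrow> 3 / 8 \<le> poly P t"
    using step_polynomial_exists[OF assms] by blast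
  obtain L where L: "pv_has_value P L" using pv_exists by blast
  define \<delta> where "\<delta> = 1 / (2 * real m)"
  have \<delta>: "0 < \<delta>" "\<delta> \<le> 1" using assms by (auto simp: \<delta>_def field_simps)
  let ?f = "\<lambda>t. sin (poly P t) / t"
  have ii: "?f integrable_on {a..b}" if "0 < a" for a b
    using that by (intro integrable_continuous_real continuous_intros) auto
  have "2 * sin (3 / 8) * ln (2 * real m) - 354 \<le> norm L"
  proof (rule pv_norm_ge[OF L \<delta>(1), of 2])
    fix a b :: real assume ab: "0 < a" "a \<le> \<delta>" "2 \<le> b"
    have f0: "0 \<le> ?f t" if "t \<in> {a..1}" for t
    proof -
      have "0 \<le> sin (poly P t)" using rng[of t] that ab by (intro sin_ge_zero) auto
      then show ?thesis using that ab by simp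
    qed
    have "((\<lambda>t. sin (3 / 8) * (1 / t)) has_integral sin (3 / 8) * (ln 1 - ln \<delta>)) {\<delta>..1}"
      using \<delta>
      by (intro has_integral_mult_right fundamental_theorem_of_calculus)
        (auto simp flip: has_real_derivative_iff_has_vector_derivative simp: divide_inverse intro!: DERIV_ln[THEN DERIV_subset])
    then have "sin (3 / 8) * (ln 1 - ln \<delta>) \<le> integral {\<delta>..1} ?f"
    proof (rule has_integral_le[OF _ integrable_integral[OF ii[OF \<delta>(1)]]])
      fix t assume t: "t \<in> {\<delta>..1}"
      have "sin (3 / 8) \<le> sin (poly P t)"
        using low[of t, folded \<delta>_def] rng[of t] t \<delta> pi_gt_zero by (intro sin_monotone_2pi_le) auto
      then show "sin (3 / 8) * (1 / t) \<le> ?f t" using t \<delta> by (simp add: divide_right_mono)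
    qed
    also have "\<dots> \<le> integral {a..1} ?f"
      using ab \<delta> f0 by (intro integral_subset_le ii) auto
    finally have "sin (3 / 8) * ln (2 * real m) \<le> integral {a..1} ?f"
      using assms by (simp add: \<delta>_def ln_div)
    moreover have "norm (trunc_int P a 1) = 2 * \<bar>integral {a..1} ?f\<bar>"
    proof -
      have "a \<le> 1" using ab \<delta> by simp
      from trunc_int_odd[OF odd ab(1) this integrable_integral[OF ii[OF ab(1)]]]
      show ?thesis by (simp add: norm_mult)
    qed
    moreover have "norm (trunc_int P 1 2) \<le> 2"
      using norm_triangle_ineq4[of "integral {1..2} (osc P)" "integral {1..2} (osc (reflect P))"]
        norm_integral_osc_le[of 1 1 2 P] norm_integral_osc_le[of 1 1 2 "reflect P"]
      by (simp add: trunc_int_eq)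
    \<comment> \<open>The leading term has size at least 1 at scale 2, so the tail estimate starts
      there with \<open>N = m\<^sup>2 + 1\<close>, block index 0.\<close>
    moreover have "norm (trunc_int P 2 b) \<le> 352"
      using norm_trunc_int_tail_le[of "m\<^sup>2 + 1" P 2 "2 * m\<^sup>2 + 1" 0 2 b] P ab by simp
    ultimately have main: "2 * sin (3 / 8) * ln (2 * real m) - 354 \<le>
        norm (trunc_int P a 1) - (norm (trunc_int P 1 2) + norm (trunc_int P 2 b))"
      by linarith
    have split: "trunc_int P a b = trunc_int P a 1 + (trunc_int P 1 2 + trunc_int P 2 b)"
      using ab \<delta> trunc_int_combine[of a 1 b P] trunc_int_combine[of 1 2 b P] by simp
    have "norm (trunc_int P a 1) - (norm (trunc_int P 1 2) + norm (trunc_int P 2 b)) \<le> norm (trunc_int P a b)"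
      unfolding split
      using norm_diff_ineq[of "trunc_int P a 1" "trunc_int P 1 2 + trunc_int P 2 b"]
        norm_triangle_ineq[of "trunc_int P 1 2" "trunc_int P 2 b"] by linarith
    then show "2 * sin (3 / 8) * ln (2 * real m) - 354 \<le> norm (trunc_int P a b)"
      using main by linarith
  qed
  then show ?thesis using P(1) L by blast
qed

text \<open>Once \<open>d\<close> passes \<open>8 * m\<^sup>2\<close> it equals
  \<open>2 * (2 * m)\<^sup>2 + 1\<close>, so \<open>m\<close> can be doubled.\<close>

lemma quadratic_scale_exists:
  assumes "d \<ge> (3::nat)"
  shows "\<exists>m\<ge>1. 2 * m\<^sup>2 + 1 \<le> d \<and> d \<le> 8 * m\<^sup>2"
  using assms
proof (induction d rule: dec_induct)
  case base
  then show ?case by (intro exI[of _ 1]) simp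
next
  case (step n)
  then obtain m where m: "m \<ge> 1" "2 * m\<^sup>2 + 1 \<le> n" "n \<le> 8 * m\<^sup>2" by blast
  show ?case
  proof (cases "Suc n \<le> 8 * m\<^sup>2")
    case True
    then show ?thesis using m by (intro exI[of _ m]) simp
  next
    case False
    moreover have "m\<^sup>2 \<ge> 1" using m(1) by simp
    ultimately show ?thesis using m by (intro exI[of _ "2 * m"]) (simp add: power_mult_distrib)
  qed
qed

theorem mainTheorem1:
  shows "\<exists>c1 c2 :: real. c1 > 0 \<and> c2 > 0 \<and>
    (\<forall>d::nat. d \<ge> 2 \<longrightarrow>
       (\<forall>P :: real poly. degree P \<le> d \<longrightarrow>
          (\<exists>L. pv_has_value P L \<and> norm L \<le> c2 * ln (real d))) \<and>
       c1 * ln (real d) \<le> Sup {norm L | L P. degree P \<le> d \<and> pv_has_value P L})"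
proof -
  define s :: real where "s = sin (3 / 8)"
  \<comment> \<open>Here \<open>1416 = 4 * 354\<close>. If \<open>ln d \<ge> 1416 / s\<close>, the
    loss 354 is at most \<open>s / 4 * ln d\<close>, which leaves \<open>s / 4 * ln d\<close> out of
    \<open>2 * s * ln (2 * m) \<ge> s / 2 * ln d\<close>. Otherwise
    \<open>c1 * ln d \<le> pi\<close>, the value attained by \<open>P = x\<close>.\<close>
  define c1 where "c1 = min (s / 4) (pi * s / 1416)"
  define c2 :: real where "c2 = 708 / ln 2"
  have s: "0 < s" "s \<le> 1"
    unfolding s_def using pi_gt3 by (auto intro!: sin_gt_zero)
  have upper: "\<exists>L. pv_has_value P L \<and> norm L \<le> c2 * ln (real d)" if "degree P \<le> d" "d \<ge> 2" for P d
    using pv_exists[of P] pv_norm_le_ln that unfolding c2_def by blast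
  have lower: "c1 * ln (real d) \<le> Sup {norm L | L P. degree P \<le> d \<and> pv_has_value P L}"
    if d: "d \<ge> 2" for d
  proof -
    \<comment> \<open>The real \<open>Sup\<close> dominates the elements of a set only when the set
      is bounded above, so the upper bound enters here as well.\<close>
    have bdd: "bdd_above {norm L | L P. degree P \<le> d \<and> pv_has_value P L}"
      using pv_norm_le_ln d by (intro bdd_aboveI[of _ "c2 * ln (real d)"]) (auto simp: c2_def)
    have ln0: "0 \<le> ln (real d)" using d by simp
    have "\<exists>P L. degree P \<le> d \<and> pv_has_value P L \<and> c1 * ln (real d) \<le> norm L"
    proof (cases "1416 / s \<le> ln (real d)")
      case True
      \<comment> \<open>A large logarithm rules out \<open>d = 2\<close>, for which no admissible
        \<open>m\<close> exists.\<close>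
      have "1416 \<le> 1416 / s" using s by (simp add: field_simps)
      then have "d \<noteq> 2" using True ln_le_minus_one[of "2::real"] by (auto simp del: ln_2_less_1)
      then obtain m where m: "m \<ge> 1" "2 * m\<^sup>2 + 1 \<le> d" "d \<le> 8 * m\<^sup>2"
        using quadratic_scale_exists[of d] d by auto
      obtain P L where PL: "degree P = 2 * m\<^sup>2 + 1" "pv_has_value P L" "2 * s * ln (2 * real m) - 354 \<le> norm L"
        using pv_large_exists[OF m(1)] unfolding s_def by blast
      have "d \<le> (2 * m) ^ 4"
      proof -
        have "m\<^sup>2 * 1 \<le> m\<^sup>2 * m\<^sup>2" using m(1) by (intro mult_left_mono) auto
        then have "8 * m\<^sup>2 \<le> 16 * (m\<^sup>2 * m\<^sup>2)" by simp
        also have "\<dots> = (2 * m) ^ 4" by (simp add: power_mult_distrib flip: power_add)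
        finally show ?thesis using m(3) by simp
      qed
      then have "real d \<le> (2 * real m) ^ 4" by (metis of_nat_le_iff of_nat_power of_nat_mult of_nat_numeral)
      then have "ln (real d) \<le> ln ((2 * real m) ^ 4)" using d m(1) by (intro ln_mono) auto
      also have "\<dots> = 4 * ln (2 * real m)" using m(1) by (subst ln_realpow) auto
      finally have "s * ln (real d) \<le> s * (4 * ln (2 * real m))" using s by (intro mult_left_mono) auto
      moreover have "1416 \<le> s * ln (real d)" using True s by (simp add: field_simps)
      moreover have "c1 * ln (real d) \<le> s / 4 * ln (real d)"
        using ln0 by (intro mult_right_mono) (auto simp: c1_def)
      ultimately have "c1 * ln (real d) \<le> norm L" using PL(3) by simp
      then show ?thesis using PL m(2) by (metis order_refl)
    next
      case False
      have "c1 * ln (real d) \<le> pi * s / 1416 * (1416 / s)"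
        using False ln0 s by (intro mult_mono) (auto simp: c1_def)
      also have "\<dots> = norm (\<i> * complex_of_real pi)" using s by (simp add: norm_mult)
      finally show ?thesis using pv_linear d by (intro exI[of _ "[:0, 1:]"] exI) auto
    qed
    then obtain P L where "degree P \<le> d" "pv_has_value P L" "c1 * ln (real d) \<le> norm L" by blast
    then show ?thesis by (intro order_trans[OF _ cSup_upper[OF _ bdd]]) auto
  qed
  have "c1 > 0" "c2 > 0" using s by (auto simp: c1_def c2_def)
  then show ?thesis using upper lower by blast
qed

end
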